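(* Let $t\in(0,1)$, let $\omega = (w_{1}, \dots, w_{n})$ be a positive probability vector, and let $\mathbb{A} = (A_{1}, \dots, A_{n}) \in \mathbb{P}_{m}^{n}$. The barycenter $\mathfrak{B}_{t}(\omega; \mathbb{A}) = \mathfrak{B}_{t}(\omega; A_{1}, \dots, A_{n})$ satisfies the following: (1) If $A_{1}, \dots, A_{n}$ commute (pairwise), then $$\mathfrak{B}_{t}(\omega; \mathbb{A}) = \left( \sum_{j=1}^{n} w_{j} A_{j}^{1-t} \right)^{\frac{1}{1-t}}.$$ (2) $\mathfrak{B}_{t}(\omega_{\sigma}; \mathbb{A}_{\sigma}) = \mathfrak{B}_{t}(\omega; \mathbb{A})$ for any permutation $\sigma$ of $\{1,\dots,n\}$, where $\omega_\sigma = (w_{\sigma(1)},\dots,w_{\sigma(n)})$ and $\mathbb{A}_\sigma = (A_{\sigma(1)},\dots,A_{\sigma(n)})$. (3) $\mathfrak{B}_{t}(\omega; U \mathbb{A} U^{*}) = U \mathfrak{B}_{t}(\omega; \mathbb{A}) U^{*}$ for any $m\times m$ unitary matrix $U$, where $U\mathbb{A}U^* = (UA_1U^*,\dots,UA_nU^* )$.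
   Context: $\mathbb{P}_{m}$ denotes the set of $m \times m$ complex (Hermitian) positive definite matrices. Real powers of positive definite matrices are defined by functional calculus. A positive probability vector is $\omega=(w_1,\dots,w_n)$ with all $w_j>0$ and $\sum_j w_j=1$. For $A,B\in\mathbb{P}_m$ and $t\in(0,1)$: $A \nabla_{t} B := (1-t) A + t B$; $A \sharp_{t} B := A^{1/2} (A^{-1/2} B A^{-1/2})^{t} A^{1/2}$; $F_{t}(A, B) := (A^{-1} \sharp_{t} B)^{1/2} A^{2-2t} (A^{-1} \sharp_{t} B)^{1/2}$; and $\Phi(A, B) := \operatorname{tr}[A \nabla_{t} B - F_{t}(A, B)]$. The barycenter $\mathfrak{B}_{t}(\omega; A_{1}, \dots, A_{n})$ is the unique minimizer over $X\in\mathbb{P}_m$ of $\sum_{j=1}^{n} w_{j} \Phi(A_{j}, X)$, i.e. $\mathfrak{B}_{t}(\omega; A_{1}, \dots, A_{n}) = \arg\min_{X \in \mathbb{P}_{m}} \sum_{j=1}^{n} w_{j} \Phi(A_{j}, X)$. *)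

theory Defs
  imports "HOL-Analysis.Analysis"
begin

definition adjoint_mat :: "complex^'n^'m \<Rightarrow> complex^'m^'n" where
  "adjoint_mat A = (\<chi> i j. cnj (A $ j $ i))"

definition hermitian_mat :: "complex^'m^'m \<Rightarrow> bool" where
  "hermitian_mat A \<longleftrightarrow> adjoint_mat A = A"

definition unitary_mat :: "complex^'m^'m \<Rightarrow> bool" where
  "unitary_mat U \<longleftrightarrow> adjoint_mat U ** U = mat 1 \<and> U ** adjoint_mat U = mat 1"

(* For Hermitian A the form x* A x is real, so taking Re only changes the type. *)
definition posdef_mats :: "(complex^'m^'m) set" where
  "posdef_mats = {A. hermitian_mat A \<and>
     (\<forall>x. x \<noteq> 0 \<longrightarrow> 0 < Re (\<Sum>i\<in>UNIV. cnj (x $ i) * (A *v x) $ i))}"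

definition real_diag_mat :: "('m \<Rightarrow> real) \<Rightarrow> complex^'m^'m" where
  "real_diag_mat d = (\<chi> i j. if i = j then complex_of_real (d i) else 0)"

(* Functional calculus for Hermitian A: if A = U diag(d) U* with U unitary and d real, then
   f(A) = U diag(f o d) U*, which does not depend on the chosen diagonalization.
   For non-Hermitian A the value is unspecified. *)
definition fun_calc :: "(real \<Rightarrow> real) \<Rightarrow> complex^'m^'m \<Rightarrow> complex^'m^'m" where
  "fun_calc f A = (THE B. \<exists>U d. unitary_mat U \<and>
     A = U ** real_diag_mat d ** adjoint_mat U \<and>
     B = U ** real_diag_mat (\<lambda>i. f (d i)) ** adjoint_mat U)"

definition mat_powr :: "complex^'m^'m \<Rightarrow> real \<Rightarrow> complex^'m^'m" where
  "mat_powr A r = fun_calc (\<lambda>x. x powr r) A"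

definition arith_mean :: "real \<Rightarrow> complex^'m^'m \<Rightarrow> complex^'m^'m \<Rightarrow> complex^'m^'m" where
  "arith_mean t A B = (1 - t) *\<^sub>R A + t *\<^sub>R B"

definition geom_mean :: "real \<Rightarrow> complex^'m^'m \<Rightarrow> complex^'m^'m \<Rightarrow> complex^'m^'m" where
  "geom_mean t A B =
     mat_powr A (1/2) ** mat_powr (mat_powr A (-1/2) ** B ** mat_powr A (-1/2)) t ** mat_powr A (1/2)"

definition F_mean :: "real \<Rightarrow> complex^'m^'m \<Rightarrow> complex^'m^'m \<Rightarrow> complex^'m^'m" where
  "F_mean t A B =
     mat_powr (geom_mean t (matrix_inv A) B) (1/2) ** mat_powr A (2 - 2*t) **
     mat_powr (geom_mean t (matrix_inv A) B) (1/2)"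

(* For positive definite A and B the matrix under the trace is Hermitian, so its trace is real
   and Re only changes the type. *)
definition Phi :: "real \<Rightarrow> complex^'m^'m \<Rightarrow> complex^'m^'m \<Rightarrow> real" where
  "Phi t A B = Re (trace (arith_mean t A B - F_mean t A B))"

(* The tuples (w_1,...,w_n) and (A_1,...,A_n) are functions on nat of which only the values
   at 1..n are used. *)
definition barycenter ::
  "real \<Rightarrow> nat \<Rightarrow> (nat \<Rightarrow> real) \<Rightarrow> (nat \<Rightarrow> complex^'m^'m) \<Rightarrow> complex^'m^'m" where
  "barycenter t n w A =
     (THE X. is_arg_min (\<lambda>X. \<Sum>j=1..n. w j * Phi t (A j) X) (\<lambda>X. X \<in> posdef_mats) X)"

definition pos_prob_vector :: "nat \<Rightarrow> (nat \<Rightarrow> real) \<Rightarrow> bool" where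
  "pos_prob_vector n w \<longleftrightarrow> (\<forall>j\<in>{1..n}. 0 < w j) \<and> (\<Sum>j=1..n. w j) = 1"

end

theory Submission
  imports Defs
begin

text \<open>Cyclicity of the trace removes the outer square roots in \<open>F_mean\<close>: for positive definite \<open>A\<close>
and \<open>X\<close> the trace of \<open>F_t(A, X)\<close> is \<open>tr (A^(1-2t) (A^(1/2) X A^(1/2))^t)\<close>, called
\<open>fidelity t A X\<close> below. Hence the barycenter minimizes, up to an additive constant,
\<open>f(X) = t tr X - (\<Sum>j. w j * fidelity t (A j) X)\<close>
over the positive definite matrices.

The barycenter is a definite description, so a matrix can be identified with it only once \<open>f\<close> is known
to have exactly one minimizer.

Uniqueness is strict midpoint convexity of \<open>f\<close>, that is, strict concavity of
\<open>X \<mapsto> tr (C X^t)\<close> for positive definite \<open>C\<close>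
(\<open>trace_powr_strictly_midpoint_concave\<close>). The scalar identity
\<open>const \<cdot> y^t = \<integral> l^(t-1) y/(l+y) dl\<close> over \<open>l > 0\<close> reduces it to the functions
\<open>X \<mapsto> X (l+X)^(-1)\<close>, whose quadratic form at \<open>x\<close> is the minimum over \<open>w\<close> of
\<open>|x - w|^2 + \<langle>w, X w\<rangle>/l\<close> (\<open>harmonic_variational\<close>). A minimum of functions that are affine and increasing in \<open>X\<close> is concave
and increasing, and the unique minimizer \<open>w\<close> determines \<open>X\<close>, which gives strictness. Monotonicity,
which is the Loewner-Heinz inequality, comes from the same formula.

Existence is compactness. A large trace makes \<open>f\<close> large, because the fidelities grow only like the
power \<open>t < 1\<close> of the trace. Near the boundary of the cone the power \<open>t\<close> has infinite slope, so
adding a small fixed multiple \<open>\<delta>\<close> of the identity to a matrix that is not already bounded below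
by \<open>\<delta>\<close> does not increase \<open>f\<close> (\<open>objective_shift_decreases\<close>). What remains is a compact set on which \<open>f\<close> is continuous.

Permuting the data does not change the function that is minimized. For the other two claims it is
enough to exhibit a minimizer. Conjugation by a unitary matrix transports \<open>f\<close>, and with it the
minimizer. If the \<open>A_j\<close> commute,
they are diagonal in one orthonormal basis \<open>u_i\<close>. The tangent inequality for \<open>y^t\<close>, applied along that
basis, bounds each fidelity from above by an affine function of the diagonal entries
\<open>\<langle>u_i, X u_i\<rangle>\<close>, with equality at the claimed matrix. Its slopes sum to \<open>t\<close> in each direction and cancel
the term \<open>t tr X\<close>, so \<open>f\<close> is bounded below by its value at that matrix.\<close>

section \<open>Simultaneous diagonalization of commuting Hermitian matrices\<close>

text \<open>The Rayleigh quotient attains its maximum \<open>\<mu>\<close> over the unit sphere of \<open>W\<close>, and its first variation at a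
maximizer \<open>v\<close> in the direction of the residual \<open>f v - \<mu> v\<close>, which stays in \<open>W\<close>, forces the
residual to vanish.\<close>

lemma selfadjoint_eigenvector:
  fixes f :: "'a::euclidean_space \<Rightarrow> 'a"
  assumes W: "subspace W" "W \<noteq> {0}" and lin: "linear f"
    and sa: "\<And>x y. f x \<bullet> y = x \<bullet> f y" and inv: "\<And>x. x \<in> W \<Longrightarrow> f x \<in> W"
  obtains v \<mu> where "v \<in> W" "norm v = 1" "f v = \<mu> *\<^sub>R v"
proof -
  let ?S = "W \<inter> sphere 0 1"
  obtain w where w: "w \<in> W" "w \<noteq> 0"
    using W subspace_0 by blast
  have "(1 / norm w) *\<^sub>R w \<in> ?S"
    using w W(1) by (simp add: subspace_scale)
  then have ne: "?S \<noteq> {}" by blast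
  have cpt: "compact ?S"
    by (intro closed_Int_compact closed_subspace W compact_sphere)
  have "continuous_on ?S (\<lambda>x. x \<bullet> f x)"
    by (intro continuous_intros linear_continuous_on linear_conv_bounded_linear[THEN iffD1] lin)
  from continuous_attains_sup[OF cpt ne this]
  obtain v where v: "v \<in> W" "norm v = 1" and mx: "\<And>x. x \<in> W \<Longrightarrow> norm x = 1 \<Longrightarrow> x \<bullet> f x \<le> v \<bullet> f v"
    by auto
  define \<mu> where "\<mu> = v \<bullet> f v"
  have ray: "x \<bullet> f x \<le> \<mu> * (x \<bullet> x)" if "x \<in> W" for x
  proof (cases "x = 0")
    case False
    have "((1 / norm x) *\<^sub>R x) \<bullet> f ((1 / norm x) *\<^sub>R x) \<le> \<mu>"
      unfolding \<mu>_def by (rule mx) (use False that W(1) in \<open>auto simp: subspace_scale\<close>)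
    then have "(x \<bullet> f x) / (norm x)^2 \<le> \<mu>"
      by (simp add: linear_scale[OF lin] power2_eq_square)
    then show ?thesis
      using False by (simp add: divide_le_eq power2_norm_eq_inner)
  qed (simp add: linear_0[OF lin])
  define u where "u = f v - \<mu> *\<^sub>R v"
  have uW: "u \<in> W"
    unfolding u_def by (intro subspace_diff subspace_scale W inv v)
  define q where "q = u \<bullet> f u - \<mu> * (u \<bullet> u)"
  have quad: "2 * s * (u \<bullet> u) + s^2 * q \<le> 0" for s :: real
  proof -
    have "v + s *\<^sub>R u \<in> W" by (intro subspace_add subspace_scale W v uW)
    from ray[OF this] have "(v + s *\<^sub>R u) \<bullet> f (v + s *\<^sub>R u) - \<mu> * ((v + s *\<^sub>R u) \<bullet> (v + s *\<^sub>R u)) \<le> 0"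
      by simp
    moreover have vv: "v \<bullet> v = 1" using v by (simp add: norm_eq_1)
    have vfu: "v \<bullet> f u = u \<bullet> f v" using sa[of v u] by (simp add: inner_commute)
    have "(v + s *\<^sub>R u) \<bullet> f (v + s *\<^sub>R u) = \<mu> + 2 * s * (u \<bullet> f v) + s^2 * (u \<bullet> f u)"
      by (simp add: linear_add[OF lin] linear_scale[OF lin] inner_add_left inner_add_right \<mu>_def
          vfu power2_eq_square distrib_left)
    moreover have "(v + s *\<^sub>R u) \<bullet> (v + s *\<^sub>R u) = 1 + 2 * s * (u \<bullet> v) + s^2 * (u \<bullet> u)"
      by (simp add: inner_add_left inner_add_right vv inner_commute[of v u] power2_eq_square distrib_left)
    moreover have "u \<bullet> f v = u \<bullet> u + \<mu> * (u \<bullet> v)"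
      by (subst (2) u_def) (simp add: inner_diff_right)
    ultimately have "(\<mu> + 2 * s * (u \<bullet> u + \<mu> * (u \<bullet> v)) + s^2 * (u \<bullet> f u))
        - \<mu> * (1 + 2 * s * (u \<bullet> v) + s^2 * (u \<bullet> u)) \<le> 0" by metis
    then show ?thesis
      unfolding q_def by (simp add: algebra_simps)
  qed
  \<comment> \<open>a quadratic without constant term that is never positive has no linear term\<close>
  have "u \<bullet> u = 0"
  proof (rule ccontr)
    assume "u \<bullet> u \<noteq> 0"
    then have p: "u \<bullet> u > 0" using inner_gt_zero_iff by auto
    define r where "r = \<bar>q\<bar> + 1"
    have r: "r > 0" "- q < r" by (auto simp: r_def)
    have "2 * ((u \<bullet> u) / r) * (u \<bullet> u) + ((u \<bullet> u) / r)^2 * q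
       = (u \<bullet> u)^2 / r^2 * (2 * r + q)"
      using r by (simp add: field_simps power2_eq_square)
    moreover have "\<dots> > 0" using p r by (intro mult_pos_pos divide_pos_pos) auto
    ultimately show False using quad[of "(u \<bullet> u) / r"] by linarith
  qed
  then have "f v = \<mu> *\<^sub>R v" by (simp add: u_def)
  with v that show ?thesis by blast
qed

text \<open>The eigenspace of the first map inside \<open>W\<close> is invariant under all the maps that commute with it, so
the induction can continue inside that eigenspace.\<close>
lemma common_eigenvector:
  fixes fs :: "('a::euclidean_space \<Rightarrow> 'a) list"
  assumes "subspace W" "W \<noteq> {0}"
    and "\<And>f. f \<in> set fs \<Longrightarrow> linear f"
    and "\<And>f x y. f \<in> set fs \<Longrightarrow> f x \<bullet> y = x \<bullet> f y"
    and "\<And>f x. f \<in> set fs \<Longrightarrow> x \<in> W \<Longrightarrow> f x \<in> W"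
    and "\<And>f g x. f \<in> set fs \<Longrightarrow> g \<in> set fs \<Longrightarrow> f (g x) = g (f x)"
  shows "\<exists>v\<in>W. norm v = 1 \<and> (\<forall>f\<in>set fs. \<exists>\<mu>. f v = \<mu> *\<^sub>R v)"
  using assms
proof (induction fs arbitrary: W)
  case Nil
  obtain w where w: "w \<in> W" "w \<noteq> 0"
    using Nil subspace_0 by blast
  then have "(1 / norm w) *\<^sub>R w \<in> W" "norm ((1 / norm w) *\<^sub>R w) = 1"
    using Nil by (auto simp: subspace_scale)
  then show ?case by (metis empty_iff list.set(1))
next
  case (Cons f fs)
  obtain v \<mu> where v: "v \<in> W" "norm v = 1" "f v = \<mu> *\<^sub>R v"
    using selfadjoint_eigenvector[of W f] Cons.prems by (metis list.set_intros(1))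
  have lin: "linear f" using Cons.prems by simp
  define E where "E = {x \<in> W. f x = \<mu> *\<^sub>R x}"
  have "subspace E"
    using Cons.prems(1) unfolding E_def subspace_def
    by (auto simp: linear_0[OF lin] linear_add[OF lin] linear_scale[OF lin] scaleR_add_right)
  moreover have "v \<in> E" "v \<noteq> 0" using v by (simp_all add: E_def) (metis norm_zero zero_neq_one)
  then have "E \<noteq> {0}" by blast
  moreover have "g x \<in> E" if "g \<in> set fs" "x \<in> E" for g x
  proof -
    have "f (g x) = g (f x)" using Cons.prems(6)[of f g] that by simp
    also have "\<dots> = \<mu> *\<^sub>R g x"
      using that Cons.prems(3)[of g] by (simp add: E_def linear_scale)
    finally show ?thesis using Cons.prems(5)[of g x] that by (simp add: E_def)
  qed
  ultimately have "\<exists>v\<in>E. norm v = 1 \<and> (\<forall>f\<in>set fs. \<exists>\<mu>. f v = \<mu> *\<^sub>R v)"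
    using Cons.prems by (intro Cons.IH) auto
  then show ?case by (auto simp: E_def)
qed

text \<open>The Hermitian inner product; the library inner product on \<open>complex^'m\<close> is its real part. Orthogonality
of eigenvectors has to be taken in the Hermitian sense to obtain a unitary matrix.\<close>
definition cip :: "complex^'m \<Rightarrow> complex^'m \<Rightarrow> complex" where
  "cip x y = (\<Sum>i\<in>UNIV. cnj (x $ i) * y $ i)"

lemma inner_eq_Re_cip: "x \<bullet> y = Re (cip x y)"
  by (simp add: cip_def inner_vec_def inner_complex_def)

lemma cip_self: "cip x x = complex_of_real ((norm x)^2)"
proof -
  have "cip x x = complex_of_real (\<Sum>i\<in>UNIV. (cmod (x $ i))^2)"
    unfolding cip_def of_real_sum
    by (intro sum.cong refl) (metis complex_norm_square mult.commute)
  also have "(\<Sum>i\<in>UNIV. (cmod (x $ i))^2) = (norm x)^2"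
    by (simp add: norm_vec_def L2_set_def sum_nonneg)
  finally show ?thesis .
qed

lemma cip_adjoint: "cip x (A *v y) = cip (adjoint_mat A *v x) y"
proof -
  have "cip x (A *v y) = (\<Sum>i\<in>UNIV. \<Sum>j\<in>UNIV. cnj (x $ i) * (A $ i $ j * y $ j))"
    by (simp add: cip_def matrix_vector_mult_def sum_distrib_left)
  also have "\<dots> = (\<Sum>j\<in>UNIV. \<Sum>i\<in>UNIV. cnj (x $ i) * (A $ i $ j * y $ j))"
    by (rule sum.swap)
  also have "\<dots> = cip (adjoint_mat A *v x) y"
    by (simp add: cip_def matrix_vector_mult_def adjoint_mat_def sum_distrib_left sum_distrib_right mult_ac)
  finally show ?thesis .
qed

lemma adjoint_mat_adjoint_mat [simp]: "adjoint_mat (adjoint_mat A) = A"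
  by (simp add: adjoint_mat_def vec_eq_iff)

lemma adjoint_mult: "adjoint_mat (A ** B) = adjoint_mat B ** adjoint_mat A"
  by (simp add: adjoint_mat_def matrix_matrix_mult_def vec_eq_iff mult.commute)

lemma adjoint_add: "adjoint_mat (A + B) = adjoint_mat A + adjoint_mat B"
  by (simp add: adjoint_mat_def vec_eq_iff)

lemma adjoint_scaleR: "adjoint_mat (c *\<^sub>R A) = c *\<^sub>R adjoint_mat A"
  by (simp add: adjoint_mat_def vec_eq_iff)

lemma adjoint_mat_1 [simp]: "adjoint_mat (mat 1) = mat 1"
  by (auto simp add: adjoint_mat_def mat_def vec_eq_iff)

lemma inner_adjoint: "x \<bullet> (A *v y) = (adjoint_mat A *v x) \<bullet> (y :: complex^'m)"
  by (simp add: inner_eq_Re_cip cip_adjoint)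

lemma matrix_vector_scaleR: "(A :: complex^'n^'m) *v (c *\<^sub>R x) = c *\<^sub>R (A *v x)"
  by (simp add: matrix_vector_mult_def vec_eq_iff scaleR_sum_right)

lemma scaleR_matrix_vector: "(c *\<^sub>R (A :: complex^'n^'m)) *v x = c *\<^sub>R (A *v x)"
  by (simp add: matrix_vector_mult_def vec_eq_iff scaleR_sum_right)

lemma linear_matrix_vector: "linear (\<lambda>x. (A :: complex^'n^'m) *v x)"
  by (intro linearI) (simp_all add: matrix_vector_right_distrib matrix_vector_scaleR)

text \<open>Adding one index at a time: the vectors that are orthogonal to the eigenvectors found so far form a
space that is invariant under the Hermitian matrices, and it contains a further common eigenvector.\<close>
lemma simultaneous_diagonalization_vectors:
  fixes As :: "(complex^'m^'m) list" and I :: "'m set"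
  assumes herm: "\<And>A. A \<in> set As \<Longrightarrow> hermitian_mat A"
    and comm: "\<And>A B. A \<in> set As \<Longrightarrow> B \<in> set As \<Longrightarrow> A ** B = B ** A"
  shows "\<exists>v :: 'm \<Rightarrow> complex^'m. (\<forall>i\<in>I. \<forall>j\<in>I. cip (v i) (v j) = (if i = j then 1 else 0)) \<and>
           (\<forall>i\<in>I. \<forall>A\<in>set As. \<exists>\<mu>::real. A *v v i = \<mu> *\<^sub>R v i)"
proof -
  have "finite I" by simp
  then show ?thesis
  proof (induction I)
    case (insert k I)
    then obtain v :: "'m \<Rightarrow> complex^'m" where
      orth: "\<forall>i\<in>I. \<forall>j\<in>I. cip (v i) (v j) = (if i = j then 1 else 0)" and
      eig: "\<forall>i\<in>I. \<forall>A\<in>set As. \<exists>\<mu>::real. A *v v i = \<mu> *\<^sub>R v i" by blast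
    define W where "W = {x. \<forall>i\<in>I. cip (v i) x = 0}"
    have sub: "subspace W"
      unfolding W_def subspace_def cip_def
      by (auto simp: distrib_left sum.distrib scaleR_sum_right[symmetric])
    have ne: "W \<noteq> {0}"
    proof -
      \<comment> \<open>row \<open>k\<close> is zero, so the linear equations that define \<open>W\<close> have a nontrivial solution\<close>
      define B :: "complex^'m^'m" where "B = (\<chi> i j. if i \<in> I then cnj (v i $ j) else 0)"
      have "row k B = 0" using insert by (simp add: row_def B_def vec_eq_iff)
      then have "det B = 0" by (rule det_zero_row)
      then have "\<not> invertible B" by (simp add: invertible_det_nz)
      then have "\<not> (\<forall>x. B *v x = 0 \<longrightarrow> x = 0)"
        using matrix_left_invertible_ker[of B] matrix_left_right_inverse[of _ B]
        unfolding invertible_def by blast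
      then obtain x where x: "B *v x = 0" "x \<noteq> 0" by blast
      have "cip (v i) x = 0" if "i \<in> I" for i
      proof -
        have "(B *v x) $ i = 0" using x by simp
        then show ?thesis using that by (simp add: B_def matrix_vector_mult_def cip_def)
      qed
      then show ?thesis using x by (auto simp: W_def)
    qed
    have inv: "A *v x \<in> W" if "A \<in> set As" "x \<in> W" for A x
    proof -
      have "cip (v i) (A *v x) = 0" if i: "i \<in> I" for i
      proof -
        obtain \<mu> :: real where "A *v v i = \<mu> *\<^sub>R v i" using eig i \<open>A \<in> set As\<close> by blast
        then have "cip (v i) (A *v x) = cip (\<mu> *\<^sub>R v i) x"
          using herm[OF \<open>A \<in> set As\<close>] by (simp add: cip_adjoint hermitian_mat_def)
        also have "\<dots> = \<mu> *\<^sub>R cip (v i) x"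
          by (simp add: cip_def scaleR_sum_right)
        finally show ?thesis using \<open>x \<in> W\<close> i by (simp add: W_def)
      qed
      then show ?thesis by (simp add: W_def)
    qed
    have "\<exists>u\<in>W. norm u = 1 \<and> (\<forall>f\<in>set (map (*v) As). \<exists>\<mu>. f u = \<mu> *\<^sub>R u)"
      by (rule common_eigenvector[OF sub ne])
        (use inv herm comm in \<open>auto simp: linear_matrix_vector inner_adjoint hermitian_mat_def
           matrix_vector_mul_assoc\<close>)
    then obtain u where u: "u \<in> W" "norm u = 1" "\<forall>A\<in>set As. \<exists>\<mu>. A *v u = \<mu> *\<^sub>R u"
      by auto
    have flip: "cip u (v i) = 0" if "i \<in> I" for i
    proof -
      have "cip u (v i) = cnj (cip (v i) u)" by (simp add: cip_def mult.commute)
      then show ?thesis using u that by (simp add: W_def)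
    qed
    have "cip u u = 1" using u by (simp add: cip_self)
    then show ?case
      using orth eig u insert(2)
      by (intro exI[of _ "v(k := u)"]) (auto simp: W_def flip)
  qed auto
qed

definition diag_in :: "complex^'m^'m \<Rightarrow> ('m \<Rightarrow> real) \<Rightarrow> complex^'m^'m" where
  "diag_in U d = U ** real_diag_mat d ** adjoint_mat U"

lemma matrix_mult_diag: "(A ** real_diag_mat d) $ i $ j = A $ i $ j * complex_of_real (d j)"
proof -
  have "(A ** real_diag_mat d) $ i $ j = (\<Sum>k\<in>UNIV. if k = j then A $ i $ j * complex_of_real (d j) else 0)"
    unfolding matrix_matrix_mult_def real_diag_mat_def
    by (simp add: if_distrib[of "\<lambda>x. _ * x"] cong: if_cong)
  then show ?thesis by simp
qed

lemma diag_mult_matrix: "(real_diag_mat d ** A) $ i $ j = complex_of_real (d i) * A $ i $ j"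
proof -
  have "(real_diag_mat d ** A) $ i $ j = (\<Sum>k\<in>UNIV. if k = i then complex_of_real (d i) * A $ i $ j else 0)"
    unfolding matrix_matrix_mult_def real_diag_mat_def
    by (simp add: if_distrib[of "\<lambda>x. x * _"] cong: if_cong)
  then show ?thesis by simp
qed

theorem simultaneous_diagonalization:
  fixes As :: "(complex^'m^'m) list"
  assumes herm: "\<And>A. A \<in> set As \<Longrightarrow> hermitian_mat A"
    and comm: "\<And>A B. A \<in> set As \<Longrightarrow> B \<in> set As \<Longrightarrow> A ** B = B ** A"
  obtains U where "unitary_mat U" "\<And>A. A \<in> set As \<Longrightarrow> \<exists>d. A = diag_in U d"
proof -
  obtain v :: "'m \<Rightarrow> complex^'m" where
    orth: "\<And>i j. cip (v i) (v j) = (if i = j then 1 else 0)" and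
    eig: "\<And>i A. A \<in> set As \<Longrightarrow> \<exists>\<mu>::real. A *v v i = \<mu> *\<^sub>R v i"
    using simultaneous_diagonalization_vectors[of As UNIV] assms by (simp only: UNIV_I ball_UNIV) blast
  define U :: "complex^'m^'m" where "U = (\<chi> i j. v j $ i)"
  have 1: "adjoint_mat U ** U = mat 1"
    using orth by (simp add: vec_eq_iff matrix_matrix_mult_def adjoint_mat_def U_def mat_def cip_def)
  then have U: "unitary_mat U"
    using matrix_left_right_inverse[of U "adjoint_mat U"] by (simp add: unitary_mat_def)
  have "\<exists>d. A = diag_in U d" if A: "A \<in> set As" for A
  proof -
    obtain d :: "'m \<Rightarrow> real" where d: "\<And>i. A *v v i = d i *\<^sub>R v i"
      using eig[OF A] by metis
    have "(A ** U) $ i $ j = (U ** real_diag_mat d) $ i $ j" for i j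
    proof -
      have "(A ** U) $ i $ j = (A *v v j) $ i"
        by (simp add: matrix_matrix_mult_def matrix_vector_mult_def U_def)
      also have "\<dots> = (U ** real_diag_mat d) $ i $ j"
        unfolding d matrix_mult_diag
        by (simp add: U_def scaleR_conv_of_real[where 'a = complex] mult.commute)
      finally show ?thesis .
    qed
    then have "A ** U = U ** real_diag_mat d" by (simp add: vec_eq_iff)
    then have "diag_in U d = A ** (U ** adjoint_mat U)"
      by (simp add: diag_in_def matrix_mul_assoc)
    then show ?thesis using U by (auto simp: unitary_mat_def)
  qed
  with U that show ?thesis by blast
qed

corollary hermitian_spectral:
  assumes "hermitian_mat A"
  obtains U d where "unitary_mat U" "A = diag_in U d"
proof -
  obtain U where "unitary_mat U" "\<And>B. B \<in> set [A] \<Longrightarrow> \<exists>d. B = diag_in U d"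
    by (rule simultaneous_diagonalization[of "[A]"]) (use assms in auto)
  with that show ?thesis by auto
qed

lemma hermitian_diag_in: "hermitian_mat (diag_in U d)"
proof -
  have "adjoint_mat (real_diag_mat d) = real_diag_mat d"
    by (auto simp: adjoint_mat_def real_diag_mat_def vec_eq_iff)
  then show ?thesis
    by (simp add: hermitian_mat_def diag_in_def adjoint_mult matrix_mul_assoc)
qed

text \<open>The functional calculus does not depend on the diagonalization: if \<open>U D U* = V E V*\<close>, then \<open>V* U\<close>
intertwines \<open>D\<close> and \<open>E\<close>, so it has nonzero entries only where the eigenvalues agree, and hence it also
intertwines \<open>f(D)\<close> and \<open>f(E)\<close>.\<close>
lemma fun_calc_diag_in:
  assumes U: "unitary_mat U"
  shows "fun_calc f (diag_in U d) = diag_in U (\<lambda>i. f (d i))"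
  unfolding fun_calc_def
proof (rule the_equality)
  show "\<exists>V e. unitary_mat V \<and> diag_in U d = V ** real_diag_mat e ** adjoint_mat V \<and>
     diag_in U (\<lambda>i. f (d i)) = V ** real_diag_mat (\<lambda>i. f (e i)) ** adjoint_mat V"
    using U by (intro exI[of _ U] exI[of _ d]) (simp add: diag_in_def)
next
  fix B assume "\<exists>V e. unitary_mat V \<and> diag_in U d = V ** real_diag_mat e ** adjoint_mat V \<and>
     B = V ** real_diag_mat (\<lambda>i. f (e i)) ** adjoint_mat V"
  then obtain V e where V: "unitary_mat V" and eq: "diag_in U d = diag_in V e"
    and B: "B = diag_in V (\<lambda>i. f (e i))" by (auto simp: diag_in_def)
  define W where "W = adjoint_mat V ** U"
  have conj: "adjoint_mat V ** diag_in U g ** U = W ** real_diag_mat g"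
    "adjoint_mat V ** diag_in V g ** U = real_diag_mat g ** W" for g
  proof -
    have "adjoint_mat V ** diag_in U g ** U = W ** real_diag_mat g ** (adjoint_mat U ** U)"
      by (simp add: W_def diag_in_def matrix_mul_assoc)
    then show "adjoint_mat V ** diag_in U g ** U = W ** real_diag_mat g"
      using U by (simp add: unitary_mat_def)
    have "adjoint_mat V ** diag_in V g ** U = (adjoint_mat V ** V) ** real_diag_mat g ** W"
      by (simp add: W_def diag_in_def matrix_mul_assoc)
    then show "adjoint_mat V ** diag_in V g ** U = real_diag_mat g ** W"
      using V by (simp add: unitary_mat_def)
  qed
  have ent: "W $ i $ j * complex_of_real (d j) = complex_of_real (e i) * W $ i $ j" for i j
    using conj(1)[of d] conj(2)[of e] eq by (metis matrix_mult_diag diag_mult_matrix)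
  have "W $ i $ j * complex_of_real (f (d j)) = complex_of_real (f (e i)) * W $ i $ j" for i j
    using ent[of i j] by (cases "W $ i $ j = 0") auto
  then have "W ** real_diag_mat (\<lambda>i. f (d i)) = real_diag_mat (\<lambda>i. f (e i)) ** W"
    by (simp add: vec_eq_iff matrix_mult_diag diag_mult_matrix)
  then have *: "adjoint_mat V ** diag_in U (\<lambda>i. f (d i)) ** U = adjoint_mat V ** B ** U"
    using conj B by simp
  have strip: "V ** (adjoint_mat V ** C ** U) ** adjoint_mat U = C" for C
  proof -
    have "V ** (adjoint_mat V ** C ** U) ** adjoint_mat U = (V ** adjoint_mat V) ** C ** (U ** adjoint_mat U)"
      by (simp add: matrix_mul_assoc)
    then show ?thesis using U V by (simp add: unitary_mat_def)
  qed
  show "B = diag_in U (\<lambda>i. f (d i))" by (metis * strip)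
qed

section \<open>Positive definite matrices and their real powers\<close>

definition qf :: "complex^'m^'m \<Rightarrow> complex^'m \<Rightarrow> real" where
  "qf A x = x \<bullet> (A *v x)"

lemma posdef_iff: "A \<in> posdef_mats \<longleftrightarrow> hermitian_mat A \<and> (\<forall>x. x \<noteq> 0 \<longrightarrow> 0 < qf A x)"
  by (simp add: posdef_mats_def qf_def inner_eq_Re_cip cip_def)

lemma qf_add: "qf (A + B) x = qf A x + qf B x"
  by (simp add: qf_def matrix_vector_mult_add_rdistrib inner_add_right)

lemma qf_diff: "qf (A - B) x = qf A x - qf B x"
  by (simp add: qf_def matrix_vector_mult_diff_rdistrib inner_diff_right)

lemma qf_scaleR: "qf (c *\<^sub>R A) x = c * qf A x"
  by (simp add: qf_def scaleR_matrix_vector)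

lemma qf_mat_1: "qf (mat 1) x = (norm x)^2"
  by (simp add: qf_def power2_norm_eq_inner)

lemma qf_nonneg: "A \<in> posdef_mats \<Longrightarrow> 0 \<le> qf A x"
  by (cases "x = 0") (auto simp: posdef_iff qf_def less_imp_le)

lemma qf_congruence: "qf (adjoint_mat S ** A ** S) x = qf A (S *v x)"
  by (simp add: qf_def inner_adjoint[of x] adjoint_mult adjoint_mat_adjoint_mat matrix_vector_mul_assoc[symmetric]
      inner_adjoint[symmetric])

lemma hermitian_add: "hermitian_mat A \<Longrightarrow> hermitian_mat B \<Longrightarrow> hermitian_mat (A + B)"
  by (simp add: hermitian_mat_def adjoint_add)

lemma hermitian_scaleR: "hermitian_mat A \<Longrightarrow> hermitian_mat (c *\<^sub>R A)"
  by (simp add: hermitian_mat_def adjoint_scaleR)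

lemma posdef_add: "A \<in> posdef_mats \<Longrightarrow> B \<in> posdef_mats \<Longrightarrow> A + B \<in> posdef_mats"
  by (simp add: posdef_iff hermitian_add qf_add add_pos_pos)

lemma posdef_scaleR: "A \<in> posdef_mats \<Longrightarrow> c > 0 \<Longrightarrow> c *\<^sub>R A \<in> posdef_mats"
  by (simp add: posdef_iff hermitian_scaleR qf_scaleR)

lemma posdef_mat_1: "mat 1 \<in> posdef_mats"
  by (simp add: posdef_iff qf_mat_1 hermitian_mat_def)

lemma unitary_adjoint: "unitary_mat U \<Longrightarrow> unitary_mat (adjoint_mat U)"
  by (simp add: unitary_mat_def adjoint_mat_adjoint_mat)

lemma norm_unitary:
  assumes "unitary_mat U" shows "norm (U *v x) = norm x"
proof -
  have "(norm (U *v x))^2 = (norm x)^2"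
    using qf_congruence[of U "mat 1" x] assms by (simp add: qf_mat_1 unitary_mat_def)
  then show ?thesis by simp
qed

lemma real_diag_mat_vec: "(real_diag_mat d *v x) $ i = complex_of_real (d i) * x $ i"
  by (simp add: real_diag_mat_def matrix_vector_mult_def if_distrib[of "\<lambda>y. y * _"] cong: if_cong)

lemma qf_diag_in: "qf (diag_in U d) x = (\<Sum>i\<in>UNIV. d i * (cmod ((adjoint_mat U *v x) $ i))^2)"
proof -
  have "qf (diag_in U d) x = qf (real_diag_mat d) (adjoint_mat U *v x)"
    using qf_congruence[of "adjoint_mat U" "real_diag_mat d" x]
    by (simp add: diag_in_def adjoint_mat_adjoint_mat)
  also have "\<dots> = (\<Sum>i\<in>UNIV. d i * (cmod ((adjoint_mat U *v x) $ i))^2)"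
    unfolding qf_def inner_vec_def real_diag_mat_vec
    by (intro sum.cong refl)
      (simp add: scaleR_conv_of_real[symmetric] power2_norm_eq_inner)
  finally show ?thesis .
qed

lemma sum_coordinates_unitary:
  assumes "unitary_mat U"
  shows "(\<Sum>i\<in>UNIV. (cmod ((adjoint_mat U *v x) $ i))^2) = (norm x)^2"
proof -
  have "(\<Sum>i\<in>UNIV. (cmod ((adjoint_mat U *v x) $ i))^2) = (norm (adjoint_mat U *v x))^2"
    by (simp add: norm_vec_def L2_set_def sum_nonneg)
  then show ?thesis using norm_unitary[OF unitary_adjoint[OF assms]] by simp
qed

lemma matrix_vector_column: "(A *v column k B) $ i = (A ** B) $ i $ k"
  by (simp add: matrix_vector_mult_def matrix_matrix_mult_def column_def)

lemma coordinates_column: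
  "unitary_mat U \<Longrightarrow> (adjoint_mat U *v column k U) $ i = (if i = k then 1 else 0)"
  by (simp add: matrix_vector_column unitary_mat_def mat_def)

lemma qf_diag_in_column: "unitary_mat U \<Longrightarrow> qf (diag_in U d) (column k U) = d k"
  by (simp add: qf_diag_in coordinates_column if_distrib[of "\<lambda>x. _ * x"] if_distrib[of cmod]
      if_distrib[of "\<lambda>x. x^2"] cong: if_cong)

lemma diag_in_mult:
  assumes "unitary_mat U"
  shows "diag_in U d ** diag_in U e = diag_in U (\<lambda>i. d i * e i)"
proof -
  have "diag_in U d ** diag_in U e = U ** real_diag_mat d ** (adjoint_mat U ** U) ** real_diag_mat e ** adjoint_mat U"
    by (simp add: diag_in_def matrix_mul_assoc)
  also have "\<dots> = U ** (real_diag_mat d ** real_diag_mat e) ** adjoint_mat U"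
    using assms by (simp add: unitary_mat_def matrix_mul_assoc)
  also have "real_diag_mat d ** real_diag_mat e = real_diag_mat (\<lambda>i. d i * e i)"
    by (simp add: vec_eq_iff diag_mult_matrix) (simp add: real_diag_mat_def)
  finally show ?thesis by (simp add: diag_in_def)
qed

lemma matrix_add_rdistrib: "(A + B) ** (C :: 'a::semiring_1^'n^'m) = A ** C + B ** C"
  by (simp add: matrix_matrix_mult_def vec_eq_iff distrib_right sum.distrib)

lemma diag_in_add: "diag_in U d + diag_in U e = diag_in U (\<lambda>i. d i + e i)"
proof -
  have "real_diag_mat (\<lambda>i. d i + e i) = real_diag_mat d + real_diag_mat e"
    by (simp add: real_diag_mat_def vec_eq_iff)
  then show ?thesis by (simp add: diag_in_def matrix_add_ldistrib matrix_add_rdistrib)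
qed

lemma diag_in_scaleR: "c *\<^sub>R diag_in U d = diag_in U (\<lambda>i. c * d i)"
proof -
  have "real_diag_mat (\<lambda>i. c * d i) = c *\<^sub>R real_diag_mat d"
    by (simp add: real_diag_mat_def vec_eq_iff) (simp add: scaleR_conv_of_real)
  then show ?thesis by (simp add: diag_in_def scalar_matrix_assoc matrix_scalar_ac)
qed

lemma diag_in_const:
  assumes "unitary_mat U" shows "diag_in U (\<lambda>_. c) = c *\<^sub>R mat 1"
proof -
  have "real_diag_mat (\<lambda>_. 1) = (mat 1 :: complex^'a^'a)"
    by (auto simp: real_diag_mat_def mat_def vec_eq_iff)
  then have "diag_in U (\<lambda>_. 1) = mat 1" using assms by (simp add: diag_in_def unitary_mat_def)
  then show ?thesis using diag_in_scaleR[of c U "\<lambda>_. 1"] by simp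
qed

lemma diag_in_diff: "diag_in U d - diag_in U e = diag_in U (\<lambda>i. d i - e i)"
  using diag_in_add[of U "\<lambda>i. d i - e i" e] by (simp add: algebra_simps)

lemma diag_in_sum:
  assumes "unitary_mat U" "finite J"
  shows "(\<Sum>j\<in>J. diag_in U (d j)) = diag_in U (\<lambda>i. \<Sum>j\<in>J. d j i)"
  using assms(2) by (induction J) (simp_all add: diag_in_add diag_in_const[OF assms(1)])

lemma norm_column_unitary: "unitary_mat U \<Longrightarrow> norm (column i U) = 1"
  using qf_diag_in_column[of U "\<lambda>_. 1" i]
  by (simp add: diag_in_const qf_mat_1 power2_eq_1_iff) (smt (verit) norm_ge_zero)

text \<open>Expressing the trace against a diagonalized matrix through quadratic forms is what lets inequalities
between quadratic forms pass to traces.\<close>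
lemma Re_trace_diag_in_mult:
  "Re (trace (diag_in U d ** Z)) = (\<Sum>i\<in>UNIV. d i * qf Z (column i U))"
proof -
  have "trace (diag_in U d ** Z) = trace (U ** (real_diag_mat d ** (adjoint_mat U ** Z)))"
    by (simp add: diag_in_def matrix_mul_assoc)
  also have "\<dots> = trace (real_diag_mat d ** (adjoint_mat U ** Z ** U))"
    by (subst trace_mul_sym) (simp add: matrix_mul_assoc)
  also have "\<dots> = (\<Sum>i\<in>UNIV. complex_of_real (d i) * (adjoint_mat U ** Z ** U) $ i $ i)"
    by (simp add: trace_def diag_mult_matrix)
  also have "\<dots> = (\<Sum>i\<in>UNIV. complex_of_real (d i) * cip (column i U) (Z *v column i U))"
  proof -
    have "(adjoint_mat U ** Z ** U) $ i $ i = cip (column i U) (Z *v column i U)" for i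
      by (simp add: matrix_mul_assoc[symmetric] matrix_vector_column cip_def)
        (simp add: matrix_matrix_mult_def[of "adjoint_mat U"], simp add: adjoint_mat_def column_def)
    then show ?thesis by simp
  qed
  finally show ?thesis by (simp add: qf_def inner_eq_Re_cip)
qed

lemma Re_trace_diag_in:
  assumes "unitary_mat U" shows "Re (trace (diag_in U d)) = (\<Sum>i\<in>UNIV. d i)"
  using Re_trace_diag_in_mult[of U d "mat 1"] by (simp add: qf_mat_1 norm_column_unitary[OF assms])

lemma posdef_diag_in:
  assumes U: "unitary_mat U"
  shows "diag_in U d \<in> posdef_mats \<longleftrightarrow> (\<forall>i. 0 < d i)"
proof
  assume "diag_in U d \<in> posdef_mats"
  moreover have "column i U \<noteq> 0" for i
  proof
    assume "column i U = 0"
    then show False using coordinates_column[OF U, of i i] by simp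
  qed
  ultimately show "\<forall>i. 0 < d i" by (metis posdef_iff qf_diag_in_column[OF U])
next
  assume d: "\<forall>i. 0 < d i"
  have "0 < qf (diag_in U d) x" if "x \<noteq> 0" for x
  proof -
    have "adjoint_mat U *v x \<noteq> 0"
      using norm_unitary[OF unitary_adjoint[OF U], of x] that by (metis norm_eq_zero)
    then obtain i where "(adjoint_mat U *v x) $ i \<noteq> 0" by (auto simp: vec_eq_iff)
    then show ?thesis
      unfolding qf_diag_in using d
      by (intro sum_pos2[of _ i]) (auto simp: less_imp_le)
  qed
  then show "diag_in U d \<in> posdef_mats" by (simp add: posdef_iff hermitian_diag_in)
qed

lemma posdef_spectral:
  assumes "A \<in> posdef_mats"
  obtains U d where "unitary_mat U" "A = diag_in U d" "\<And>i. 0 < d i"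
  using assms hermitian_spectral[of A] posdef_diag_in by (metis posdef_iff)

lemma mat_powr_diag_in: "unitary_mat U \<Longrightarrow> mat_powr (diag_in U d) r = diag_in U (\<lambda>i. d i powr r)"
  by (simp add: mat_powr_def fun_calc_diag_in)

lemma mat_powr_posdef: "A \<in> posdef_mats \<Longrightarrow> mat_powr A r \<in> posdef_mats"
  by (erule posdef_spectral) (metis mat_powr_diag_in posdef_diag_in powr_gt_zero less_irrefl)

lemma mat_powr_add: "A \<in> posdef_mats \<Longrightarrow> mat_powr A r ** mat_powr A s = mat_powr A (r + s)"
  by (erule posdef_spectral) (simp add: mat_powr_diag_in diag_in_mult powr_add)

lemma mat_powr_mult: "A \<in> posdef_mats \<Longrightarrow> mat_powr (mat_powr A r) s = mat_powr A (r * s)"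
  by (erule posdef_spectral) (simp add: mat_powr_diag_in powr_powr)

lemma mat_powr_0: "A \<in> posdef_mats \<Longrightarrow> mat_powr A 0 = mat 1"
proof (erule posdef_spectral)
  fix U :: "complex^'a^'a" and d
  assume U: "unitary_mat U" and A: "A = diag_in U d" and d: "\<And>i. 0 < d i"
  have "d i \<noteq> 0" for i using d[of i] by simp
  then show "mat_powr A 0 = mat 1"
    using diag_in_const[of U 1] U A by (simp add: mat_powr_diag_in)
qed

lemma mat_powr_1: "A \<in> posdef_mats \<Longrightarrow> mat_powr A 1 = A"
  by (erule posdef_spectral) (simp add: mat_powr_diag_in less_imp_le)

lemma matrix_inv_unique:
  fixes A :: "complex^'m^'m"
  assumes "A ** B = mat 1" "B ** A = mat 1" shows "matrix_inv A = B"
proof -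
  have "A ** matrix_inv A = mat 1 \<and> matrix_inv A ** A = mat 1"
    unfolding matrix_inv_def by (rule someI[of _ B]) (use assms in simp)
  then have "B = B ** A ** matrix_inv A" by (simp add: matrix_mul_assoc[symmetric])
  then show ?thesis using assms by simp
qed

lemma matrix_inv_posdef: "A \<in> posdef_mats \<Longrightarrow> matrix_inv A = mat_powr A (- 1)"
  using mat_powr_add[of A 1 "-1"] mat_powr_add[of A "-1" 1]
  by (intro matrix_inv_unique) (simp_all add: mat_powr_1 mat_powr_0)

lemma posdef_congruence:
  assumes "S \<in> posdef_mats" "X \<in> posdef_mats"
  shows "S ** X ** S \<in> posdef_mats"
  unfolding posdef_iff
proof (intro conjI allI impI)
  have S: "adjoint_mat S = S" "adjoint_mat X = X" using assms by (auto simp: posdef_iff hermitian_mat_def)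
  then show "hermitian_mat (S ** X ** S)"
    by (simp add: hermitian_mat_def adjoint_mult matrix_mul_assoc)
  fix x :: "complex^'a" assume "x \<noteq> 0"
  have "S *v x \<noteq> 0"
  proof
    assume "S *v x = 0"
    then have "qf S x = 0" by (simp add: qf_def)
    then show False using assms(1) \<open>x \<noteq> 0\<close> by (auto simp: posdef_iff)
  qed
  then show "0 < qf (S ** X ** S) x"
    using qf_congruence[of S X x] S assms(2) by (simp add: posdef_iff)
qed

lemma diag_in_unitary_conj: "U ** diag_in V d ** adjoint_mat U = diag_in (U ** V) d"
  by (simp add: diag_in_def adjoint_mult matrix_mul_assoc)

lemma unitary_mult:
  assumes "unitary_mat U" "unitary_mat V" shows "unitary_mat (U ** V)"
proof -
  have "adjoint_mat V ** adjoint_mat U ** (U ** V) = adjoint_mat V ** (adjoint_mat U ** U) ** V"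
    "U ** V ** (adjoint_mat V ** adjoint_mat U) = U ** (V ** adjoint_mat V) ** adjoint_mat U"
    by (simp_all add: matrix_mul_assoc)
  then show ?thesis using assms by (simp add: unitary_mat_def adjoint_mult)
qed

lemma posdef_unitary_conj:
  "unitary_mat U \<Longrightarrow> A \<in> posdef_mats \<Longrightarrow> U ** A ** adjoint_mat U \<in> posdef_mats"
  by (erule posdef_spectral) (simp add: diag_in_unitary_conj unitary_mult posdef_diag_in)

lemma mat_powr_unitary_conj:
  "unitary_mat U \<Longrightarrow> A \<in> posdef_mats \<Longrightarrow>
    mat_powr (U ** A ** adjoint_mat U) r = U ** mat_powr A r ** adjoint_mat U"
  by (erule posdef_spectral) (simp add: diag_in_unitary_conj unitary_mult mat_powr_diag_in)

lemma unitary_conj_mult: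
  assumes "unitary_mat U"
  shows "(U ** A ** adjoint_mat U) ** (U ** B ** adjoint_mat U) = U ** (A ** B) ** adjoint_mat U"
proof -
  have "(U ** A ** adjoint_mat U) ** (U ** B ** adjoint_mat U)
      = U ** A ** (adjoint_mat U ** U) ** B ** adjoint_mat U"
    by (simp add: matrix_mul_assoc)
  also have "\<dots> = U ** A ** B ** adjoint_mat U"
    using assms by (simp add: unitary_mat_def)
  finally show ?thesis by (simp add: matrix_mul_assoc)
qed

lemma trace_unitary_conj:
  assumes "unitary_mat U" shows "trace (U ** A ** adjoint_mat U) = trace A"
proof -
  have "trace (U ** A ** adjoint_mat U) = trace (adjoint_mat U ** U ** A)"
    by (subst trace_mul_sym) (simp add: matrix_mul_assoc)
  then show ?thesis using assms by (simp add: unitary_mat_def)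
qed

section \<open>The divergence in terms of a trace of a power\<close>

definition fidelity :: "real \<Rightarrow> complex^'m^'m \<Rightarrow> complex^'m^'m \<Rightarrow> real" where
  "fidelity t A X = Re (trace (mat_powr A (1 - 2 * t) **
     mat_powr (mat_powr A (1/2) ** X ** mat_powr A (1/2)) t))"

lemma trace_scaleR: "trace (c *\<^sub>R (A :: complex^'m^'m)) = c *\<^sub>R trace A"
  by (simp add: trace_def scaleR_sum_right)

text \<open>With \<open>M = (A^(1/2) X A^(1/2))^t\<close> the weighted geometric mean of the inverse of \<open>A\<close> and \<open>X\<close> is
\<open>A^(-1/2) M A^(-1/2)\<close>. Two cyclic rotations of the trace bring its square roots together and collect
the powers of \<open>A\<close> into \<open>A^(-1/2) A^(2-2t) A^(-1/2) = A^(1-2t)\<close>.\<close>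
lemma Phi_eq_fidelity:
  assumes A: "A \<in> posdef_mats" and X: "X \<in> posdef_mats"
  shows "Phi t A X = (1 - t) * Re (trace A) + t * Re (trace X) - fidelity t A X"
proof -
  define M where "M = mat_powr (mat_powr A (1/2) ** X ** mat_powr A (1/2)) t"
  define G where "G = mat_powr A (-1/2) ** M ** mat_powr A (-1/2)"
  have M: "M \<in> posdef_mats"
    unfolding M_def by (intro mat_powr_posdef posdef_congruence A X)
  then have G: "G \<in> posdef_mats"
    unfolding G_def by (intro posdef_congruence mat_powr_posdef A)
  have geo: "geom_mean t (matrix_inv A) X = G"
    unfolding geom_mean_def G_def M_def matrix_inv_posdef[OF A] mat_powr_mult[OF A] by simp
  have sq: "mat_powr G (1/2) ** mat_powr G (1/2) = G"
    using mat_powr_add[OF G, of "1/2" "1/2"] mat_powr_1[OF G] by simp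
  have "trace (F_mean t A X) = trace (mat_powr G (1/2) ** (mat_powr A (2 - 2*t) ** mat_powr G (1/2)))"
    by (simp add: F_mean_def geo matrix_mul_assoc)
  also have "\<dots> = trace (mat_powr A (2 - 2*t) ** G)"
    by (subst trace_mul_sym) (simp add: matrix_mul_assoc[symmetric] sq)
  also have "\<dots> = trace (mat_powr A (2 - 2*t) ** mat_powr A (-1/2) ** M ** mat_powr A (-1/2))"
    by (simp add: G_def matrix_mul_assoc)
  also have "\<dots> = trace (mat_powr A (-1/2) ** mat_powr A (2 - 2*t) ** mat_powr A (-1/2) ** M)"
    by (subst trace_mul_sym) (simp add: matrix_mul_assoc)
  also have "mat_powr A (-1/2) ** mat_powr A (2 - 2*t) ** mat_powr A (-1/2) = mat_powr A (1 - 2*t)"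
    by (simp add: mat_powr_add[OF A])
  finally show ?thesis
    by (simp add: Phi_def arith_mean_def fidelity_def M_def trace_sub trace_add trace_scaleR)
qed

lemma fidelity_unitary_conj:
  assumes U: "unitary_mat U" and A: "A \<in> posdef_mats" and X: "X \<in> posdef_mats"
  shows "fidelity t (U ** A ** adjoint_mat U) (U ** X ** adjoint_mat U) = fidelity t A X"
  unfolding fidelity_def
  by (simp add: mat_powr_unitary_conj[OF U A] unitary_conj_mult[OF U] trace_unitary_conj[OF U]
      mat_powr_unitary_conj[OF U posdef_congruence[OF mat_powr_posdef[OF A] X]])

section \<open>Monotonicity and strict concavity of the power function\<close>

text \<open>The kernel is dominated by \<open>l^(t-1)\<close> near zero and by \<open>l^(t-2)\<close> near infinity; the first needs
\<open>t > 0\<close>, the second \<open>t < 1\<close>.\<close>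

lemma powr_kernel_integrable:
  fixes t :: real
  assumes "0 < t" "t < 1"
  shows "integrable lborel (\<lambda>l. indicator {0<..} l * (l powr (t - 1) / (l + 1)))"
proof -
  have 0: "set_integrable lborel {0..1} (\<lambda>l. l powr (t - 1))"
  proof -
    have "(\<lambda>l. l powr (t - 1)) absolutely_integrable_on {0..1}"
      using integrable_on_powr_from_0[of "t - 1" 1] assms
      by (intro nonnegative_absolutely_integrable_1) auto
    then show ?thesis by (simp add: set_integrable_def integrable_completion)
  qed
  have 1: "set_integrable lborel {1..} (\<lambda>l. l powr (t - 2))"
  proof -
    have "(\<lambda>l. l powr (t - 2)) absolutely_integrable_on {1..}"
      using has_integral_powr_to_inf[of "t - 2" 1] assms
      by (intro nonnegative_absolutely_integrable_1) (auto simp: integrable_on_def)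
    then show ?thesis by (simp add: set_integrable_def integrable_completion)
  qed
  have "integrable lborel (\<lambda>l. indicator {0..1} l *\<^sub>R l powr (t - 1) + indicator {1..} l *\<^sub>R l powr (t - 2))"
    using 0 1 unfolding set_integrable_def by (rule Bochner_Integration.integrable_add)
  then show ?thesis
  proof (rule Bochner_Integration.integrable_bound, goal_cases)
    case 2
    have "norm (indicator {0<..} l * (l powr (t - 1) / (l + 1)))
        \<le> norm (indicator {0..1} l *\<^sub>R l powr (t - 1) + indicator {1..} l *\<^sub>R l powr (t - 2))" for l :: real
    proof (cases "0 < l \<and> l < 1")
      case True
      then have "l powr (t - 1) / (l + 1) \<le> l powr (t - 1) / 1"
        by (intro divide_left_mono) auto
      with True show ?thesis by (auto simp: indicator_def)
    next
      case False
      show ?thesis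
      proof (cases "1 \<le> l")
        case True
        have "l powr (t - 1) / (l + 1) \<le> l powr (t - 1) / l"
          using True by (intro divide_left_mono) auto
        also have "\<dots> = l powr (t - 2)"
          using True powr_diff[of l "t - 1" 1] by simp
        finally show ?thesis using True by (auto simp: indicator_def)
      qed (use False in \<open>auto simp: indicator_def\<close>)
    qed
    then show ?case by simp
  qed measurable
qed

definition powr_const :: "real \<Rightarrow> real" where
  "powr_const t = (\<integral>l. indicator {0<..} l * (l powr (t - 1) / (l + 1)) \<partial>lborel)"

lemma integral_pos_lborel:
  fixes D :: "real \<Rightarrow> real"
  assumes "integrable lborel D" "\<And>l. 0 \<le> D l" "\<And>l. 0 < l \<Longrightarrow> 0 < D l"
  shows "0 < (\<integral>l. D l \<partial>lborel)"
proof (rule ccontr)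
  assume "\<not> ?thesis"
  moreover have "0 \<le> (\<integral>l. D l \<partial>lborel)" using assms by (intro integral_nonneg_AE) auto
  ultimately have "(\<integral>l. D l \<partial>lborel) = 0" by linarith
  then have "AE l in lborel. D l = 0"
    using integral_nonneg_eq_0_iff_AE[OF assms(1)] assms(2) by simp
  then have "AE l in lborel. l \<notin> {0<..<1::real}"
    by eventually_elim (use assms(3) in force)
  then have "emeasure lborel {0<..<1::real} = 0"
    by (subst (asm) AE_iff_measurable[where N = "{0<..<1}"]) auto
  then show False by simp
qed

lemma powr_const_pos: "0 < t \<Longrightarrow> t < 1 \<Longrightarrow> 0 < powr_const t"
  unfolding powr_const_def
  by (rule integral_pos_lborel[OF powr_kernel_integrable]) (auto simp: indicator_def)

text \<open>The substitution of \<open>l/y\<close> for \<open>l\<close> in the integral that defines \<open>powr_const t\<close>.\<close>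
lemma powr_integral_representation:
  fixes y :: real
  assumes t: "0 < t" "t < 1" and y: "0 < y"
  shows "has_bochner_integral lborel (\<lambda>l. indicator {0<..} l * (l powr (t - 1) * (y / (l + y))))
           (powr_const t * y powr t)"
proof -
  have "has_bochner_integral lborel (\<lambda>l. indicator {0<..} l * (l powr (t - 1) / (l + 1))) (powr_const t)"
    using powr_kernel_integrable[OF t] by (simp add: powr_const_def has_bochner_integral_iff)
  from this[THEN lborel_has_bochner_integral_real_affine_iff[of "1 / y" _ _ 0, THEN iffD1, rotated]] y
  have "has_bochner_integral lborel
      (\<lambda>l. indicator {0<..} (l / y) * ((l / y) powr (t - 1) / (l / y + 1))) (y * powr_const t)"
    by simp
  then have "has_bochner_integral lborel
      (\<lambda>l. y powr (t - 1) * (indicator {0<..} (l / y) * ((l / y) powr (t - 1) / (l / y + 1))))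
      (y powr (t - 1) * (y * powr_const t))"
    by (rule has_bochner_integral_mult_right)
  also have "(\<lambda>l. y powr (t - 1) * (indicator {0<..} (l / y) * ((l / y) powr (t - 1) / (l / y + 1))))
      = (\<lambda>l. indicator {0<..} l * (l powr (t - 1) * (y / (l + y))))"
  proof
    fix l :: real
    show "y powr (t - 1) * (indicator {0<..} (l / y) * ((l / y) powr (t - 1) / (l / y + 1)))
      = indicator {0<..} l * (l powr (t - 1) * (y / (l + y)))"
    proof (cases "0 < l")
      case True
      have "l / y + 1 = (l + y) / y" using y by (simp add: field_simps)
      with True y show ?thesis by (simp add: powr_divide)
    next
      case False
      then show ?thesis using y by (simp add: zero_less_divide_iff)
    qed
  qed
  also have "y powr (t - 1) * (y * powr_const t) = powr_const t * y powr t"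
    using y by (simp add: powr_diff)
  finally show ?thesis .
qed

text \<open>This is \<open>X (l + X)^(-1)\<close>, the parallel sum of \<open>X\<close> and \<open>l\<close> divided by \<open>l\<close>.\<close>
definition harmonic :: "real \<Rightarrow> complex^'m^'m \<Rightarrow> complex^'m^'m" where
  "harmonic l X = fun_calc (\<lambda>s. s / (l + s)) X"

text \<open>This is \<open>l (l + X)^(-1)\<close>, which maps \<open>x\<close> to the minimizer in the variational formula for
\<open>harmonic l X\<close>.\<close>
definition shrink :: "real \<Rightarrow> complex^'m^'m \<Rightarrow> complex^'m^'m" where
  "shrink l X = fun_calc (\<lambda>s. l / (l + s)) X"

lemma qf_mat_powr_integral:
  assumes X: "X \<in> posdef_mats" and t: "0 < t" "t < 1"
  shows "has_bochner_integral lborel (\<lambda>l. indicator {0<..} l * (l powr (t - 1) * qf (harmonic l X) x))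
           (powr_const t * qf (mat_powr X t) x)"
proof -
  obtain U d where U: "unitary_mat U" and Xd: "X = diag_in U d" and d: "\<And>i. 0 < d i"
    using posdef_spectral[OF X] by blast
  let ?c = "\<lambda>i. (cmod ((adjoint_mat U *v x) $ i))^2"
  have "has_bochner_integral lborel
     (\<lambda>l. \<Sum>i\<in>UNIV. (indicator {0<..} l * (l powr (t - 1) * (d i / (l + d i)))) * ?c i)
     (\<Sum>i\<in>UNIV. (powr_const t * d i powr t) * ?c i)"
    by (intro has_bochner_integral_sum has_bochner_integral_mult_left powr_integral_representation t d)
  then show ?thesis
    unfolding Xd harmonic_def fun_calc_diag_in[OF U] mat_powr_diag_in[OF U] qf_diag_in
    by (simp add: sum_distrib_left mult_ac)
qed

text \<open>The quadratic form of \<open>harmonic l X\<close> at \<open>x\<close> is the minimum over \<open>w\<close> of an expression that is affine in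
\<open>X\<close>. This follows by completing the square in each coordinate of an eigenbasis of \<open>X\<close>; the square
vanishes exactly at \<open>w = shrink l X *v x\<close>.\<close>
lemma harmonic_variational:
  assumes X: "X \<in> posdef_mats" and l: "0 < l"
  shows "qf (harmonic l X) x \<le> (norm (x - w))^2 + qf X w / l"
    and "qf (harmonic l X) x = (norm (x - w))^2 + qf X w / l \<longleftrightarrow> w = shrink l X *v x"
proof -
  obtain U d where U: "unitary_mat U" and Xd: "X = diag_in U d" and d: "\<And>i. 0 < d i"
    using posdef_spectral[OF X] by blast
  define a where "a = adjoint_mat U *v x"
  define b where "b = adjoint_mat U *v w"
  \<comment> \<open>\<open>r i\<close> is the completed square in coordinate \<open>i\<close>\<close>
  define r where "r i = (l + d i) / l * (cmod (b $ i - complex_of_real (l / (l + d i)) * a $ i))^2" for i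
  have r0: "0 \<le> r i" for i using d[of i] l by (simp add: r_def)
  have scalar: "(cmod (a - b))^2 + s * (cmod b)^2 / l
      = s / (l + s) * (cmod a)^2 + (l + s) / l * (cmod (b - complex_of_real (l / (l + s)) * a))^2"
    if "0 < s" for a b s
  proof -
    have p: "l + s \<noteq> 0" "l \<noteq> 0" using l that by auto
    have "(p - q)^2 + s * q^2 / l = s / (l + s) * p^2 + (l + s) / l * (q - l / (l + s) * p)^2" for p q :: real
      using p by (simp add: divide_simps power2_eq_square) algebra
    from this[of "Re a" "Re b"] this[of "Im a" "Im b"] show ?thesis
      unfolding cmod_power2 by (simp add: distrib_left add_divide_distrib)
  qed
  have "(norm (x - w))^2 + qf X w / l
      = (\<Sum>i\<in>UNIV. (cmod (a $ i - b $ i))^2) + (\<Sum>i\<in>UNIV. d i * (cmod (b $ i))^2) / l"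
    using sum_coordinates_unitary[OF U, of "x - w"]
    by (simp add: Xd qf_diag_in a_def b_def matrix_vector_mult_diff_distrib)
  also have "\<dots> = (\<Sum>i\<in>UNIV. (cmod (a $ i - b $ i))^2 + d i * (cmod (b $ i))^2 / l)"
    by (simp add: sum.distrib sum_divide_distrib)
  also have "\<dots> = (\<Sum>i\<in>UNIV. d i / (l + d i) * (cmod (a $ i))^2 + r i)"
    by (simp only: scalar[OF d] r_def)
  also have "\<dots> = qf (harmonic l X) x + sum r UNIV"
    by (simp add: Xd harmonic_def fun_calc_diag_in[OF U] qf_diag_in a_def sum.distrib)
  finally have eq: "(norm (x - w))^2 + qf X w / l = qf (harmonic l X) x + sum r UNIV" .
  show "qf (harmonic l X) x \<le> (norm (x - w))^2 + qf X w / l"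
    unfolding eq using r0 by (simp add: sum_nonneg)
  have "qf (harmonic l X) x = (norm (x - w))^2 + qf X w / l \<longleftrightarrow> sum r UNIV = 0"
    unfolding eq by auto
  also have "\<dots> \<longleftrightarrow> (\<forall>i. r i = 0)"
    using r0 by (subst sum_nonneg_eq_0_iff) auto
  also have "\<dots> \<longleftrightarrow> (\<forall>i. b $ i = (real_diag_mat (\<lambda>i. l / (l + d i)) *v a) $ i)"
  proof (intro all_cong1)
    fix i
    have "(l + d i) / l \<noteq> 0" using d[of i] l by simp
    then show "r i = 0 \<longleftrightarrow> b $ i = (real_diag_mat (\<lambda>i. l / (l + d i)) *v a) $ i"
      unfolding r_def real_diag_mat_vec by simp
  qed
  also have "\<dots> \<longleftrightarrow> b = real_diag_mat (\<lambda>i. l / (l + d i)) *v a"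
    by (simp add: vec_eq_iff)
  also have "\<dots> \<longleftrightarrow> w = shrink l X *v x"
  proof -
    have "shrink l X *v x = U *v (real_diag_mat (\<lambda>i. l / (l + d i)) *v a)"
      unfolding Xd shrink_def fun_calc_diag_in[OF U]
      by (simp add: diag_in_def a_def matrix_vector_mul_assoc matrix_mul_assoc)
    moreover have "U *v b = w"
      using U by (simp add: b_def matrix_vector_mul_assoc unitary_mat_def)
    moreover have "adjoint_mat U *v (U *v c) = c" for c
      using U by (simp add: matrix_vector_mul_assoc unitary_mat_def)
    ultimately show ?thesis by metis
  qed
  finally show "qf (harmonic l X) x = (norm (x - w))^2 + qf X w / l \<longleftrightarrow> w = shrink l X *v x" .
qed

text \<open>The inverse of \<open>shrink l X\<close> is \<open>1 + X/l\<close>, from which \<open>X\<close> can be read off.\<close>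
lemma shrink_inj:
  assumes X: "X \<in> posdef_mats" and Y: "Y \<in> posdef_mats" and l: "0 < l"
    and eq: "shrink l X = shrink l Y"
  shows "X = Y"
proof -
  have "mat_powr (shrink l Z) (- 1) = mat 1 + (1 / l) *\<^sub>R Z" if Z: "Z \<in> posdef_mats" for Z :: "complex^'m^'m"
  proof -
    obtain U d where U: "unitary_mat U" and Zd: "Z = diag_in U d" and d: "\<And>i. 0 < d i"
      using posdef_spectral[OF Z] by blast
    have "mat 1 + (1 / l) *\<^sub>R Z = diag_in U (\<lambda>i. 1 + 1 / l * d i)"
      using diag_in_const[OF U, of 1] by (simp add: Zd diag_in_scaleR diag_in_add[symmetric])
    also have "(\<lambda>i. 1 + 1 / l * d i) = (\<lambda>i. (l / (l + d i)) powr (- 1))"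
    proof
      fix i show "1 + 1 / l * d i = (l / (l + d i)) powr (- 1)"
        using d[of i] l by (simp add: powr_minus field_simps)
    qed
    finally show ?thesis
      by (simp add: Zd shrink_def fun_calc_diag_in[OF U] mat_powr_diag_in[OF U])
  qed
  from this[OF X] this[OF Y] eq have "(1 / l) *\<^sub>R X = (1 / l) *\<^sub>R Y"
    by (metis add_left_cancel)
  then show ?thesis using l by simp
qed

text \<open>A minimum of functions that increase with \<open>X\<close> increases with \<open>X\<close>: the minimizer for \<open>Y\<close> is a competitor
for \<open>X\<close>.\<close>
lemma harmonic_mono:
  assumes X: "X \<in> posdef_mats" and Y: "Y \<in> posdef_mats" and l: "0 < l"
    and le: "\<And>x. qf X x \<le> qf Y x"
  shows "qf (harmonic l X) x \<le> qf (harmonic l Y) x"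
proof -
  let ?w = "shrink l Y *v x"
  have "qf (harmonic l X) x \<le> (norm (x - ?w))^2 + qf X ?w / l" by (rule harmonic_variational[OF X l])
  also have "\<dots> \<le> (norm (x - ?w))^2 + qf Y ?w / l" using le l by (simp add: divide_right_mono)
  also have "\<dots> = qf (harmonic l Y) x" using harmonic_variational(2)[OF Y l, of x ?w] by simp
  finally show ?thesis .
qed

text \<open>The Loewner-Heinz inequality: integrate the monotonicity of \<open>harmonic l\<close> over \<open>l\<close>.\<close>
theorem loewner_heinz:
  assumes X: "X \<in> posdef_mats" and Y: "Y \<in> posdef_mats" and t: "0 < t" "t < 1"
    and le: "\<And>x. qf X x \<le> qf Y x"
  shows "qf (mat_powr X t) x \<le> qf (mat_powr Y t) x"
proof -
  have "powr_const t * qf (mat_powr X t) x \<le> powr_const t * qf (mat_powr Y t) x"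
    unfolding has_bochner_integral_integral_eq[OF qf_mat_powr_integral[OF X t, of x], symmetric]
      has_bochner_integral_integral_eq[OF qf_mat_powr_integral[OF Y t, of x], symmetric]
  proof (rule integral_mono)
    show "indicator {0<..} l * (l powr (t - 1) * qf (harmonic l X) x)
        \<le> indicator {0<..} l * (l powr (t - 1) * qf (harmonic l Y) x)" for l :: real
      using harmonic_mono[OF X Y _ le, of l x] by (auto simp: indicator_def intro!: mult_left_mono)
  qed (use qf_mat_powr_integral[OF X t, of x] qf_mat_powr_integral[OF Y t, of x] in
      \<open>simp_all add: has_bochner_integral_iff\<close>)
  then show ?thesis using powr_const_pos[OF t] by simp
qed

text \<open>The minimizer \<open>w\<close> for the midpoint competes for both endpoints, and its value is affine in the matrix.
Equality forces \<open>w\<close> to be the minimizer for both endpoints as well.\<close>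
lemma harmonic_midpoint:
  assumes X: "X \<in> posdef_mats" and Y: "Y \<in> posdef_mats" and l: "0 < l"
  defines "M \<equiv> (1/2) *\<^sub>R (X + Y)"
  shows "(qf (harmonic l X) x + qf (harmonic l Y) x) / 2 \<le> qf (harmonic l M) x"
    and "(qf (harmonic l X) x + qf (harmonic l Y) x) / 2 = qf (harmonic l M) x \<Longrightarrow>
      shrink l X *v x = shrink l Y *v x"
proof -
  have M: "M \<in> posdef_mats" unfolding M_def by (intro posdef_scaleR posdef_add X Y) simp
  let ?w = "shrink l M *v x"
  have 1: "qf (harmonic l M) x = (norm (x - ?w))^2 + qf M ?w / l"
    using harmonic_variational(2)[OF M l] by blast
  have 2: "qf M ?w = (qf X ?w + qf Y ?w) / 2"
    by (simp add: M_def qf_add qf_scaleR)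
  have 3: "qf (harmonic l X) x \<le> (norm (x - ?w))^2 + qf X ?w / l"
    and 4: "qf (harmonic l Y) x \<le> (norm (x - ?w))^2 + qf Y ?w / l"
    using harmonic_variational(1) X Y l by blast+
  have 5: "qf (harmonic l M) x = (((norm (x - ?w))^2 + qf X ?w / l) + ((norm (x - ?w))^2 + qf Y ?w / l)) / 2"
    unfolding 1 2 using l by (simp add: field_simps)
  have avg: "(p + q) / 2 \<le> (p' + q') / 2" "(p + q) / 2 = (p' + q') / 2 \<Longrightarrow> p = p' \<and> q = q'"
    if "p \<le> p'" "q \<le> q'" for p q p' q' :: real
    using that by auto
  show "(qf (harmonic l X) x + qf (harmonic l Y) x) / 2 \<le> qf (harmonic l M) x"
    unfolding 5 by (rule avg(1)[OF 3 4])
  assume eq: "(qf (harmonic l X) x + qf (harmonic l Y) x) / 2 = qf (harmonic l M) x"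
  then have "qf (harmonic l X) x = (norm (x - ?w))^2 + qf X ?w / l"
    "qf (harmonic l Y) x = (norm (x - ?w))^2 + qf Y ?w / l"
    using avg(2)[OF 3 4 eq[unfolded 5]] by blast+
  then show "shrink l X *v x = shrink l Y *v x"
    using harmonic_variational(2)[OF X l] harmonic_variational(2)[OF Y l] by metis
qed

lemma matrix_eq_on_columns:
  fixes A B U :: "complex^'m^'m"
  assumes U: "unitary_mat U" and eq: "\<And>i. A *v column i U = B *v column i U"
  shows "A = B"
proof -
  have "A ** U = B ** U" using eq by (simp add: vec_eq_iff matrix_vector_column)
  then have "A ** (U ** adjoint_mat U) = B ** (U ** adjoint_mat U)" by (metis matrix_mul_assoc)
  then show ?thesis using U by (simp add: unitary_mat_def)
qed

text \<open>In an eigenbasis of \<open>C\<close> the concavity gap is a weighted sum of gaps of quadratic forms, and each is an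
integral over \<open>l\<close> of gaps of \<open>harmonic l\<close>. For a given \<open>l\<close> the sum cannot vanish: otherwise
\<open>shrink l X\<close> and \<open>shrink l Y\<close> agree on the whole basis and \<open>X = Y\<close>. So the integrand is positive everywhere.\<close>
theorem trace_powr_strictly_midpoint_concave:
  assumes C: "C \<in> posdef_mats" and X: "X \<in> posdef_mats" and Y: "Y \<in> posdef_mats" and ne: "X \<noteq> Y"
    and t: "0 < t" "t < 1"
  shows "(Re (trace (C ** mat_powr X t)) + Re (trace (C ** mat_powr Y t))) / 2
      < Re (trace (C ** mat_powr ((1/2) *\<^sub>R (X + Y)) t))"
proof -
  obtain U c where U: "unitary_mat U" and Cc: "C = diag_in U c" and c: "\<And>i. 0 < c i"
    using posdef_spectral[OF C] by blast
  define M where "M = (1/2) *\<^sub>R (X + Y)"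
  have M: "M \<in> posdef_mats" unfolding M_def by (intro posdef_scaleR posdef_add X Y) simp
  let ?u = "\<lambda>i. column i U"
  define E where "E l i = qf (harmonic l M) (?u i) - (qf (harmonic l X) (?u i) + qf (harmonic l Y) (?u i)) / 2" for l i
  have E0: "0 \<le> E l i" if "0 < l" for l i
    using harmonic_midpoint(1)[OF X Y that] by (simp add: E_def M_def)
  have Epos: "0 < (\<Sum>i\<in>UNIV. c i * E l i)" if l: "0 < l" for l
  proof (rule ccontr)
    assume "\<not> ?thesis"
    moreover have "0 \<le> (\<Sum>i\<in>UNIV. c i * E l i)"
      using E0[OF l] c by (intro sum_nonneg mult_nonneg_nonneg) (auto simp: less_imp_le)
    ultimately have "(\<Sum>i\<in>UNIV. c i * E l i) = 0" by simp
    then have "c i * E l i = 0" for i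
      by (subst (asm) sum_nonneg_eq_0_iff) (use E0[OF l] c in \<open>auto simp: less_imp_le\<close>)
    then have "E l i = 0" for i using c[of i] by (metis less_irrefl mult_eq_0_iff)
    then have "shrink l X *v ?u i = shrink l Y *v ?u i" for i
      using harmonic_midpoint(2)[OF X Y l, of "?u i"] by (simp add: E_def M_def)
    then have "shrink l X = shrink l Y" by (rule matrix_eq_on_columns[OF U])
    then show False using shrink_inj[OF X Y l] ne by blast
  qed
  define D where "D l = (\<Sum>i\<in>UNIV. c i *
      (indicator {0<..} l * (l powr (t - 1) * qf (harmonic l M) (?u i)) -
       (indicator {0<..} l * (l powr (t - 1) * qf (harmonic l X) (?u i)) +
        indicator {0<..} l * (l powr (t - 1) * qf (harmonic l Y) (?u i))) / 2))" for l
  have D_eq: "D l = indicator {0<..} l * (l powr (t - 1) * (\<Sum>i\<in>UNIV. c i * E l i))" for l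
    by (simp add: D_def E_def sum_distrib_left algebra_simps diff_divide_distrib add_divide_distrib)
  have D: "has_bochner_integral lborel D (\<Sum>i\<in>UNIV. c i * (powr_const t * qf (mat_powr M t) (?u i) -
      (powr_const t * qf (mat_powr X t) (?u i) + powr_const t * qf (mat_powr Y t) (?u i)) / 2))"
    unfolding D_def
    by (intro has_bochner_integral_sum has_bochner_integral_mult_right has_bochner_integral_diff
        has_bochner_integral_divide_zero has_bochner_integral_add qf_mat_powr_integral X Y M t)
  have "0 < (\<integral>l. D l \<partial>lborel)"
  proof (rule integral_pos_lborel)
    show "integrable lborel D" using D by (simp add: has_bochner_integral_iff)
    show "0 < D l" if "0 < l" for l using Epos[OF that] that by (simp add: D_eq)
    then show "0 \<le> D l" for l
      by (cases "0 < l") (auto simp: less_imp_le D_eq)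
  qed
  also have "\<dots> = powr_const t * (\<Sum>i\<in>UNIV. c i * (qf (mat_powr M t) (?u i) -
      (qf (mat_powr X t) (?u i) + qf (mat_powr Y t) (?u i)) / 2))"
    unfolding has_bochner_integral_integral_eq[OF D]
    by (simp add: sum_distrib_left algebra_simps)
  finally have "0 < (\<Sum>i\<in>UNIV. c i * (qf (mat_powr M t) (?u i) -
      (qf (mat_powr X t) (?u i) + qf (mat_powr Y t) (?u i)) / 2))"
    using powr_const_pos[OF t] by (simp add: zero_less_mult_iff)
  then show ?thesis
    unfolding Cc Re_trace_diag_in_mult M_def[symmetric]
    by (simp add: algebra_simps sum.distrib sum_subtractf add_divide_distrib sum_divide_distrib)
qed

section \<open>Bounds for the fidelity\<close>

text \<open>The graph of \<open>y^t\<close> lies below its tangent at \<open>s\<close>. The inequality is Young's inequality multiplied by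
\<open>s^(t-1)\<close>.\<close>

lemma powr_tangent:
  fixes s y :: real
  assumes "0 < t" "t < 1" "0 < s" "0 < y"
  shows "y powr t \<le> s powr (t - 1) * ((1 - t) * s + t * y)"
proof -
  have "y powr t = s powr (t - 1) * (s powr (1 - t) * y powr t)"
    using assms by (simp add: mult.assoc[symmetric] powr_add[symmetric])
  also have "\<dots> \<le> s powr (t - 1) * ((1 - t) * s + t * y)"
    using assms by (intro mult_left_mono Youngs_inequality_0) auto
  finally show ?thesis .
qed

text \<open>Numbers \<open>p\<close> in the unit interval satisfy \<open>p \<le> p^t\<close>; apply this to the two fractions of \<open>x + y\<close>, which add
up to one.\<close>
lemma powr_subadditive:
  fixes x y :: real
  assumes "0 < t" "t < 1" "0 < x" "0 < y"
  shows "(x + y) powr t \<le> x powr t + y powr t"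
proof -
  have *: "p \<le> p powr t" if "0 < p" "p < 1" for p :: real
    using powr_mono'[of t 1 p] that assms by simp
  have "1 = x / (x + y) + y / (x + y)" using assms by (simp add: add_divide_distrib[symmetric])
  also have "\<dots> \<le> (x / (x + y)) powr t + (y / (x + y)) powr t"
    using assms by (intro add_mono *) (auto simp: field_simps)
  also have "\<dots> = (x powr t + y powr t) / (x + y) powr t"
    using assms by (simp add: powr_divide add_divide_distrib)
  finally show ?thesis using assms by (simp add: field_simps)
qed

lemma posdef_bounds:
  assumes A: "(A :: complex^'m^'m) \<in> posdef_mats"
  obtains a b where "0 < a" "0 < b" "\<And>x. a * (norm x)^2 \<le> qf A x" "\<And>x. qf A x \<le> b * (norm x)^2"
proof -
  obtain U d where U: "unitary_mat U" and Ad: "A = diag_in U d" and d: "\<And>i. 0 < d i"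
    using posdef_spectral[OF A] by blast
  have fin: "finite (range d)" "range d \<noteq> {}" by auto
  have "Min (range d) * (norm x)^2 \<le> qf A x \<and> qf A x \<le> Max (range d) * (norm x)^2" for x
    unfolding Ad qf_diag_in sum_coordinates_unitary[OF U, of x, symmetric] sum_distrib_left
    by (auto intro!: sum_mono mult_right_mono Min_le Max_ge)
  moreover have "0 < Min (range d)" using d fin by simp
  moreover have "0 < Max (range d)" using d fin by (metis Max_in imageE)
  ultimately show ?thesis using that by blast
qed

lemma qf_diag_in_mono:
  assumes le: "\<And>i. d i \<le> e i"
  shows "qf (diag_in U d) x \<le> qf (diag_in U e) x"
  unfolding qf_diag_in using le by (intro sum_mono mult_right_mono) auto

lemma Re_trace_mult_mono:
  assumes C: "C \<in> posdef_mats" and le: "\<And>x. qf X x \<le> qf Y x"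
  shows "Re (trace (C ** X)) \<le> Re (trace (C ** Y))"
proof -
  obtain U c where U: "unitary_mat U" and Cc: "C = diag_in U c" and c: "\<And>i. 0 < c i"
    using posdef_spectral[OF C] by blast
  show ?thesis
    unfolding Cc Re_trace_diag_in_mult using le c by (intro sum_mono mult_left_mono) (auto simp: less_imp_le)
qed

lemma qf_congruence_posdef: "S \<in> posdef_mats \<Longrightarrow> qf (S ** X ** S) x = qf X (S *v x)"
  using qf_congruence[of S X x] by (simp add: posdef_iff hermitian_mat_def)

lemma fidelity_mono:
  assumes A: "A \<in> posdef_mats" and X: "X \<in> posdef_mats" and Y: "Y \<in> posdef_mats"
    and t: "0 < t" "t < 1" and le: "\<And>x. qf X x \<le> qf Y x"
  shows "fidelity t A X \<le> fidelity t A Y"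
  unfolding fidelity_def
  by (intro Re_trace_mult_mono loewner_heinz mat_powr_posdef posdef_congruence A X Y t)
    (simp add: qf_congruence_posdef mat_powr_posdef A le)

text \<open>Congruence by \<open>A^(1/2)\<close> is injective, so strictness of the concavity survives it.\<close>
lemma sqrt_congruence_inverse:
  assumes A: "A \<in> posdef_mats"
  shows "mat_powr A (-1/2) ** (mat_powr A (1/2) ** X ** mat_powr A (1/2)) ** mat_powr A (-1/2) = X"
proof -
  have "mat_powr A (-1/2) ** (mat_powr A (1/2) ** X ** mat_powr A (1/2)) ** mat_powr A (-1/2)
     = (mat_powr A (-1/2) ** mat_powr A (1/2)) ** X ** (mat_powr A (1/2) ** mat_powr A (-1/2))"
    by (simp add: matrix_mul_assoc)
  then show ?thesis by (simp add: mat_powr_add[OF A] mat_powr_0[OF A])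
qed

lemma congruence_add: "S ** (X + Y) ** S = S ** X ** S + S ** Y ** (S :: complex^'m^'m)"
  by (simp add: matrix_add_ldistrib matrix_add_rdistrib)

lemma congruence_scaleR: "S ** (c *\<^sub>R X) ** S = c *\<^sub>R (S ** X ** (S :: complex^'m^'m))"
  by (simp add: matrix_scalar_ac scalar_matrix_assoc)

lemma fidelity_strictly_midpoint_concave:
  assumes A: "A \<in> posdef_mats" and X: "X \<in> posdef_mats" and Y: "Y \<in> posdef_mats" and ne: "X \<noteq> Y"
    and t: "0 < t" "t < 1"
  shows "(fidelity t A X + fidelity t A Y) / 2 < fidelity t A ((1/2) *\<^sub>R (X + Y))"
  unfolding fidelity_def congruence_add congruence_scaleR
  by (intro trace_powr_strictly_midpoint_concave mat_powr_posdef posdef_congruence A X Y t)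
    (metis sqrt_congruence_inverse[OF A] ne)

lemma mat_powr_scaleR:
  assumes A: "A \<in> posdef_mats" and c: "0 < c"
  shows "mat_powr (c *\<^sub>R A) t = (c powr t) *\<^sub>R mat_powr A t"
proof -
  obtain U d where U: "unitary_mat U" and Ad: "A = diag_in U d" and d: "\<And>i. 0 < d i"
    using posdef_spectral[OF A] by blast
  show ?thesis
    using c d by (simp add: Ad diag_in_scaleR mat_powr_diag_in[OF U] powr_mult less_imp_le)
qed

lemma fidelity_scaleR:
  assumes A: "A \<in> posdef_mats" and X: "X \<in> posdef_mats" and c: "0 < c"
  shows "fidelity t A (c *\<^sub>R X) = c powr t * fidelity t A X"
  unfolding fidelity_def congruence_scaleR
  by (simp add: mat_powr_scaleR[OF posdef_congruence[OF mat_powr_posdef[OF A] X] c] matrix_scalar_ac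
      scalar_matrix_assoc[symmetric] trace_scaleR)

lemma sqrt_square: "A \<in> posdef_mats \<Longrightarrow> mat_powr A (1/2) ** mat_powr A (1/2) = A"
  by (simp add: mat_powr_add mat_powr_1)

lemma sqrt_congruence_shift:
  assumes "A \<in> posdef_mats"
  shows "mat_powr A (1/2) ** (X + r *\<^sub>R mat 1) ** mat_powr A (1/2)
    = mat_powr A (1/2) ** X ** mat_powr A (1/2) + r *\<^sub>R A"
  unfolding congruence_add congruence_scaleR by (simp add: sqrt_square assms)

lemma posdef_shift: "X \<in> posdef_mats \<Longrightarrow> 0 < r \<Longrightarrow> X + r *\<^sub>R mat 1 \<in> posdef_mats"
  by (intro posdef_add posdef_scaleR posdef_mat_1)

lemma diag_in_shift: "unitary_mat U \<Longrightarrow> diag_in U d + r *\<^sub>R mat 1 = diag_in U (\<lambda>i. d i + r)"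
  by (simp add: diag_in_const[symmetric] diag_in_add)

text \<open>If \<open>A \<le> b\<close>, then shifting \<open>X\<close> by \<open>r\<close> shifts \<open>A^(1/2) X A^(1/2)\<close> by at most \<open>r b\<close>, and by subadditivity
its power \<open>t\<close> by at most \<open>(r b)^t\<close>. The bound is uniform in \<open>X\<close>, which is what continuity needs.\<close>
lemma fidelity_shift_upper:
  assumes A: "(A :: complex^'m^'m) \<in> posdef_mats" and t: "0 < t" "t < 1"
  obtains K where "0 \<le> K"
    "\<And>X r. X \<in> posdef_mats \<Longrightarrow> 0 < r \<Longrightarrow> fidelity t A (X + r *\<^sub>R mat 1) \<le> fidelity t A X + K * r powr t"
proof -
  obtain b where b: "0 < b" "\<And>x. qf A x \<le> b * (norm x)^2" using posdef_bounds[OF A] by metis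
  let ?C = "mat_powr A (1 - 2 * t)" and ?S = "mat_powr A (1/2)"
  have C: "?C \<in> posdef_mats" by (intro mat_powr_posdef A)
  define K where "K = b powr t * Re (trace ?C)"
  obtain U c where U: "unitary_mat U" and Cc: "?C = diag_in U c" and c: "\<And>i. 0 < c i"
    using posdef_spectral[OF C] by blast
  have "0 \<le> K"
    unfolding K_def Cc Re_trace_diag_in[OF U] using c
    by (intro mult_nonneg_nonneg sum_nonneg) (auto simp: less_imp_le)
  moreover have "fidelity t A (X + r *\<^sub>R mat 1) \<le> fidelity t A X + K * r powr t"
    if X: "X \<in> posdef_mats" and r: "0 < r" for X r
  proof -
    define M where "M = ?S ** X ** ?S"
    have M: "M \<in> posdef_mats" unfolding M_def by (intro mat_powr_posdef posdef_congruence A X)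
    obtain V y where V: "unitary_mat V" and My: "M = diag_in V y" and y: "\<And>i. 0 < y i"
      using posdef_spectral[OF M] by blast
    have rb: "0 < r * b" using r b by simp
    have "qf (mat_powr (M + r *\<^sub>R A) t) x \<le> qf (mat_powr M t + (r * b) powr t *\<^sub>R mat 1) x" for x
    proof -
      have "qf (mat_powr (M + r *\<^sub>R A) t) x \<le> qf (mat_powr (M + (r * b) *\<^sub>R mat 1) t) x"
        by (intro loewner_heinz posdef_add M posdef_scaleR A posdef_mat_1 r rb t)
          (use b r in \<open>simp add: qf_add qf_scaleR qf_mat_1 mult.assoc\<close>)
      also have "\<dots> \<le> qf (mat_powr M t + (r * b) powr t *\<^sub>R mat 1) x"
        unfolding My diag_in_shift[OF V] mat_powr_diag_in[OF V]
        by (intro qf_diag_in_mono powr_subadditive t y rb)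
      finally show ?thesis .
    qed
    then have "fidelity t A (X + r *\<^sub>R mat 1) \<le> Re (trace (?C ** (mat_powr M t + (r * b) powr t *\<^sub>R mat 1)))"
      unfolding fidelity_def sqrt_congruence_shift[OF A] M_def[symmetric]
      by (rule Re_trace_mult_mono[OF C])
    also have "\<dots> = fidelity t A X + K * r powr t"
      using r b by (simp add: fidelity_def M_def matrix_add_ldistrib trace_add matrix_scalar_ac
          scalar_matrix_assoc[symmetric] trace_scaleR K_def powr_mult)
    finally show ?thesis .
  qed
  ultimately show ?thesis using that by blast
qed

lemma qf_norm_bound:
  obtains \<kappa> :: real where "0 < \<kappa>"
    "\<And>(A::complex^'m^'m) (x::complex^'m). \<bar>qf A x\<bar> \<le> \<kappa> * norm A * (norm x)^2"
proof -
  have "bilinear (\<lambda>(A::complex^'m^'m) x. A *v x)"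
    unfolding bilinear_def
    by (auto intro!: linearI simp: matrix_vector_right_distrib matrix_vector_scaleR
        matrix_vector_mult_add_rdistrib scaleR_matrix_vector)
  then have bb: "bounded_bilinear (\<lambda>(A::complex^'m^'m) x. A *v x)"
    by (simp add: bilinear_conv_bounded_bilinear)
  obtain \<kappa> where \<kappa>: "0 < \<kappa>" "\<And>(A::complex^'m^'m) x. norm (A *v x) \<le> norm A * norm x * \<kappa>"
    using bounded_bilinear.pos_bounded[OF bb] by blast
  have "\<bar>qf A x\<bar> \<le> \<kappa> * norm A * (norm x)^2" for A :: "complex^'m^'m" and x
  proof -
    have "\<bar>qf A x\<bar> \<le> norm x * norm (A *v x)" unfolding qf_def by (rule Cauchy_Schwarz_ineq2)
    also have "\<dots> \<le> norm x * (norm A * norm x * \<kappa>)" by (intro mult_left_mono \<kappa>) simp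
    finally show ?thesis by (simp add: power2_eq_square mult_ac)
  qed
  with \<kappa>(1) that show ?thesis by blast
qed

text \<open>If \<open>X\<close> and \<open>Y\<close> are close, then each lies below the other shifted by a small multiple \<open>r\<close> of the identity,
so monotonicity and the uniform shift bound control the difference of the fidelities on both sides.\<close>
lemma continuous_on_fidelity:
  assumes A: "(A :: complex^'m^'m) \<in> posdef_mats" and t: "0 < t" "t < 1"
  shows "continuous_on posdef_mats (fidelity t A)"
  unfolding continuous_on_iff
proof (intro ballI allI impI)
  fix X :: "complex^'m^'m" and e :: real assume X: "X \<in> posdef_mats" and e: "0 < e"
  obtain K where K: "0 \<le> K"
    "\<And>X r. X \<in> posdef_mats \<Longrightarrow> 0 < r \<Longrightarrow> fidelity t A (X + r *\<^sub>R mat 1) \<le> fidelity t A X + K * r powr t"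
    using fidelity_shift_upper[OF A t] by blast
  obtain \<kappa> :: real where \<kappa>: "0 < \<kappa>"
    "\<And>(A::complex^'m^'m) (x::complex^'m). \<bar>qf A x\<bar> \<le> \<kappa> * norm A * (norm x)^2"
    using qf_norm_bound by blast
  \<comment> \<open>chosen so that \<open>K * r powr t < e\<close>, also when \<open>K = 0\<close>\<close>
  define r where "r = (e / (K + 1)) powr (1 / t)"
  have r: "0 < r" using e K by (simp add: r_def)
  have "K * r powr t = K * (e / (K + 1))" using t e K by (simp add: r_def powr_powr)
  also have "\<dots> < e" using e K by (simp add: field_simps)
  finally have small: "K * r powr t < e" .
  have one_sided: "fidelity t A Y \<le> fidelity t A Z + K * r powr t"
    if Y: "Y \<in> posdef_mats" and Z: "Z \<in> posdef_mats" and d: "norm (Y - Z) < r / \<kappa>" for Y Z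
  proof -
    have "qf Y x \<le> qf (Z + r *\<^sub>R mat 1) x" for x
    proof -
      have "qf Y x - qf Z x \<le> \<kappa> * norm (Y - Z) * (norm x)^2"
        using \<kappa>(2)[of "Y - Z" x] by (simp add: qf_diff)
      also have "\<dots> \<le> r * (norm x)^2"
        using d \<kappa>(1) by (intro mult_right_mono) (auto simp: field_simps)
      finally show ?thesis by (simp add: qf_add qf_scaleR qf_mat_1)
    qed
    then have "fidelity t A Y \<le> fidelity t A (Z + r *\<^sub>R mat 1)"
      by (intro fidelity_mono A Y posdef_shift Z r t)
    also have "\<dots> \<le> fidelity t A Z + K * r powr t" by (rule K(2)[OF Z r])
    finally show ?thesis .
  qed
  show "\<exists>d>0. \<forall>Y\<in>posdef_mats. dist Y X < d \<longrightarrow> dist (fidelity t A Y) (fidelity t A X) < e"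
  proof (intro exI[of _ "r / \<kappa>"] conjI ballI impI)
    show "0 < r / \<kappa>" using r \<kappa> by simp
    fix Y :: "complex^'m^'m" assume Y: "Y \<in> posdef_mats" and d: "dist Y X < r / \<kappa>"
    show "dist (fidelity t A Y) (fidelity t A X) < e"
      using one_sided[OF X Y] one_sided[OF Y X] d small
      by (simp add: dist_norm norm_minus_commute abs_less_iff)
  qed
qed

text \<open>The slope of \<open>y^t\<close> at zero is infinite, so for matrices close to the boundary of the cone a small shift
increases the fidelity at any prescribed rate \<open>R\<close>. If \<open>X\<close> is not bounded below by \<open>\<delta>\<close> and \<open>A \<le> b\<close>, then
\<open>A^(1/2) X A^(1/2)\<close> has an eigenvalue below \<open>\<delta> b\<close>. If moreover \<open>a \<le> A\<close>, then by monotonicity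
the effect of the shift is at least that of adding \<open>\<delta> a\<close> to every eigenvalue. The tangent inequality bounds the
growth of the power of the small one from below, and the others contribute nonnegative amounts.\<close>
lemma fidelity_shift_lower:
  assumes A: "(A :: complex^'m^'m) \<in> posdef_mats" and t: "0 < t" "t < 1" and R: "0 < R"
  obtains \<delta> where "0 < \<delta>"
    "\<And>X. X \<in> posdef_mats \<Longrightarrow> \<exists>x. qf X x < \<delta> * (norm x)^2 \<Longrightarrow>
       fidelity t A X + R * \<delta> \<le> fidelity t A (X + \<delta> *\<^sub>R mat 1)"
proof -
  obtain a b where a: "0 < a" "\<And>x. a * (norm x)^2 \<le> qf A x"
    and b: "0 < b" "\<And>x. qf A x \<le> b * (norm x)^2" using posdef_bounds[OF A] by metis
  let ?C = "mat_powr A (1 - 2 * t)" and ?S = "mat_powr A (1/2)"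
  have C: "?C \<in> posdef_mats" and S: "?S \<in> posdef_mats" by (intro mat_powr_posdef A)+
  obtain c where c: "0 < c" "\<And>x. c * (norm x)^2 \<le> qf ?C x" using posdef_bounds[OF C] by metis
  \<comment> \<open>solves \<open>c * t * a * (\<delta> * (a + b)) powr (t - 1) = R\<close>; the exponent \<open>t - 1\<close> is negative\<close>
  define \<delta> where "\<delta> = (R / (c * t * a)) powr (1 / (t - 1)) / (a + b)"
  have \<delta>: "0 < \<delta>" using R c t a b by (simp add: \<delta>_def)
  have "(\<delta> * (a + b)) powr (t - 1) = R / (c * t * a)"
    using R c t a b by (simp add: \<delta>_def powr_powr)
  then have calib: "c * (t * (\<delta> * a) * (\<delta> * (a + b)) powr (t - 1)) = R * \<delta>"
    using c t a by (simp add: field_simps)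
  have "fidelity t A X + R * \<delta> \<le> fidelity t A (X + \<delta> *\<^sub>R mat 1)"
    if X: "X \<in> posdef_mats" and ex: "\<exists>x. qf X x < \<delta> * (norm x)^2" for X
  proof -
    define M where "M = ?S ** X ** ?S"
    have M: "M \<in> posdef_mats" unfolding M_def by (intro posdef_congruence S X)
    obtain V y where V: "unitary_mat V" and My: "M = diag_in V y" and y: "\<And>i. 0 < y i"
      using posdef_spectral[OF M] by blast
    obtain x where x: "qf X x < \<delta> * (norm x)^2" using ex by blast
    define z where "z = mat_powr A (-1/2) *v x"
    have Sz: "?S *v z = x"
      by (simp add: z_def matrix_vector_mul_assoc mat_powr_add[OF A] mat_powr_0[OF A])
    have "qf M z < \<delta> * (norm (?S *v z))^2"
      using x by (simp add: M_def qf_congruence_posdef[OF S] Sz)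
    also have "(norm (?S *v z))^2 = qf A z"
      using qf_congruence_posdef[OF S, of "mat 1" z] by (simp add: sqrt_square[OF A] qf_mat_1)
    also have "\<delta> * qf A z \<le> qf (diag_in V (\<lambda>_. \<delta> * b)) z"
      using b \<delta> by (simp add: diag_in_const[OF V] qf_scaleR qf_mat_1 mult.assoc)
    finally have "\<not> (\<forall>k. \<delta> * b \<le> y k)"
      using qf_diag_in_mono[of "\<lambda>_. \<delta> * b" y V z] by (auto simp: My)
    then obtain k where k: "y k < \<delta> * b" by (auto simp: not_le)
    define g where "g i = (y i + \<delta> * a) powr t - y i powr t" for i
    have da: "0 < \<delta> * a" using \<delta> a by simp
    have g0: "0 \<le> g i" for i
      using y[of i] t da by (simp add: g_def powr_mono2)
    have gk: "t * (\<delta> * a) * (\<delta> * (a + b)) powr (t - 1) \<le> g k"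
    proof -
      define s where "s = y k + \<delta> * a"
      have s: "0 < s" using y[of k] da by (simp add: s_def)
      have "y k powr t \<le> s powr (t - 1) * ((1 - t) * s + t * y k)"
        by (rule powr_tangent[OF t s y])
      also have "\<dots> = s powr (t - 1) * (s - t * (\<delta> * a))" by (simp add: s_def algebra_simps)
      also have "\<dots> = s powr t - t * (\<delta> * a) * s powr (t - 1)"
        using s by (simp add: right_diff_distrib powr_diff)
      finally have "t * (\<delta> * a) * s powr (t - 1) \<le> g k" by (simp add: g_def s_def)
      moreover have "(\<delta> * (a + b)) powr (t - 1) \<le> s powr (t - 1)"
        using k s t by (intro powr_mono2') (auto simp: s_def algebra_simps)
      ultimately show ?thesis using t da by (smt (verit) mult_left_mono mult_pos_pos)
    qed
    have "R * \<delta> \<le> c * g k" unfolding calib[symmetric] using gk c by simp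
    also have "\<dots> \<le> g k * qf ?C (column k V)"
      using c(2)[of "column k V"] g0[of k]
      by (simp add: norm_column_unitary[OF V] mult.commute[of "g k"] mult_right_mono)
    also have "\<dots> \<le> (\<Sum>i\<in>UNIV. g i * qf ?C (column i V))"
      by (rule member_le_sum) (use g0 qf_nonneg[OF C] in auto)
    also have "\<dots> = Re (trace (?C ** diag_in V g))"
      by (subst trace_mul_sym) (simp only: Re_trace_diag_in_mult)
    also have "diag_in V g = mat_powr (M + (\<delta> * a) *\<^sub>R mat 1) t - mat_powr M t"
      unfolding My diag_in_shift[OF V] mat_powr_diag_in[OF V] diag_in_diff g_def ..
    also have "Re (trace (?C ** (mat_powr (M + (\<delta> * a) *\<^sub>R mat 1) t - mat_powr M t)))
        = Re (trace (?C ** mat_powr (M + (\<delta> * a) *\<^sub>R mat 1) t)) - fidelity t A X"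
    proof -
      have "trace (?C ** (P - Q)) = trace (?C ** P) - trace (?C ** Q)" for P Q
        using trace_add[of "?C ** (P - Q)" "?C ** Q"] by (simp add: matrix_add_ldistrib[symmetric])
      then show ?thesis by (simp add: fidelity_def M_def)
    qed
    also have "Re (trace (?C ** mat_powr (M + (\<delta> * a) *\<^sub>R mat 1) t)) \<le> fidelity t A (X + \<delta> *\<^sub>R mat 1)"
      unfolding fidelity_def sqrt_congruence_shift[OF A] M_def[symmetric]
      by (intro Re_trace_mult_mono[OF C] loewner_heinz posdef_add M posdef_scaleR A posdef_mat_1 da \<delta> t)
        (use a \<delta> in \<open>simp add: qf_add qf_scaleR qf_mat_1 mult.assoc\<close>)
    finally show ?thesis by simp
  qed
  with \<delta> that show ?thesis by blast
qed

section \<open>Existence and uniqueness of the minimizer\<close>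

text \<open>The sum that the barycenter minimizes, without the part that is constant in \<open>X\<close>.\<close>

definition barycenter_objective ::
  "real \<Rightarrow> nat \<Rightarrow> (nat \<Rightarrow> real) \<Rightarrow> (nat \<Rightarrow> complex^'m^'m) \<Rightarrow> complex^'m^'m \<Rightarrow> real" where
  "barycenter_objective t n w A X = t * Re (trace X) - (\<Sum>j=1..n. w j * fidelity t (A j) X)"

lemma linear_trace: "linear (\<lambda>X :: complex^'m^'m. Re (trace X))"
  by (intro linearI) (simp_all add: trace_add trace_scaleR)

lemma trace_shift: "Re (trace (X + r *\<^sub>R mat 1 :: complex^'m^'m)) = Re (trace X) + r * real CARD('m)"
  by (simp add: trace_add trace_scaleR trace_I)

lemma linear_qf: "linear (\<lambda>A. qf A x)"
  by (intro linearI) (simp_all add: qf_add qf_scaleR)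

lemma linear_adjoint: "linear (\<lambda>A :: complex^'m^'m. adjoint_mat A)"
  by (intro linearI) (simp_all add: adjoint_add adjoint_scaleR)

lemma linear_imp_continuous_on:
  fixes f :: "'a::euclidean_space \<Rightarrow> 'b::real_normed_vector"
  shows "linear f \<Longrightarrow> continuous_on S f"
  by (intro linear_continuous_on) (simp add: linear_conv_bounded_linear)

lemma inner_eq_Re_trace: "X \<bullet> Y = Re (trace (adjoint_mat X ** (Y :: complex^'m^'m)))"
proof -
  have "X \<bullet> Y = (\<Sum>j\<in>UNIV. \<Sum>i\<in>UNIV. Re (cnj (X $ i $ j) * Y $ i $ j))"
    by (subst sum.swap) (simp add: inner_vec_def inner_complex_def)
  then show ?thesis
    by (simp add: trace_def matrix_matrix_mult_def adjoint_mat_def Re_sum)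
qed

lemma posdef_trace_bounds:
  assumes X: "(X :: complex^'m^'m) \<in> posdef_mats"
  shows "norm X \<le> Re (trace X)" "qf X x \<le> Re (trace X) * (norm x)^2" "0 < Re (trace X)"
proof -
  obtain U d where U: "unitary_mat U" and Xd: "X = diag_in U d" and d: "\<And>i. 0 < d i"
    using posdef_spectral[OF X] by metis
  have tr: "Re (trace X) = sum d UNIV" by (simp add: Xd Re_trace_diag_in[OF U])
  show pos: "0 < Re (trace X)" unfolding tr using d by (intro sum_pos) auto
  have le: "d i \<le> sum d UNIV" for i
    by (rule member_le_sum) (use d in \<open>auto simp: less_imp_le\<close>)
  have "qf X x \<le> qf (diag_in U (\<lambda>_. sum d UNIV)) x"
    unfolding Xd by (rule qf_diag_in_mono[OF le])
  then show "qf X x \<le> Re (trace X) * (norm x)^2"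
    by (simp add: tr diag_in_const[OF U] qf_scaleR qf_mat_1)
  have "adjoint_mat X = X" using X by (simp add: posdef_iff hermitian_mat_def)
  then have "(norm X)^2 = (\<Sum>i\<in>UNIV. d i * d i)"
    by (simp add: power2_norm_eq_inner inner_eq_Re_trace Xd diag_in_mult[OF U] Re_trace_diag_in[OF U])
  also have "\<dots> \<le> (\<Sum>i\<in>UNIV. sum d UNIV * d i)"
    using le d by (intro sum_mono mult_right_mono) (auto simp: less_imp_le)
  also have "\<dots> = (Re (trace X))^2" by (simp add: tr sum_distrib_left power2_eq_square)
  finally show "norm X \<le> Re (trace X)" by (rule power2_le_imp_le) (use pos in simp)
qed

lemma sum_Phi_eq_objective:
  assumes "\<forall>j\<in>{1..n}. A j \<in> posdef_mats" and X: "X \<in> posdef_mats" and "(\<Sum>j=1..n. w j) = 1"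
  shows "(\<Sum>j=1..n. w j * Phi t (A j) X)
    = (1 - t) * (\<Sum>j=1..n. w j * Re (trace (A j))) + barycenter_objective t n w A X"
proof -
  have "(\<Sum>j=1..n. w j * Phi t (A j) X)
     = (\<Sum>j=1..n. (1 - t) * (w j * Re (trace (A j))) + w j * (t * Re (trace X)) - w j * fidelity t (A j) X)"
    using assms(1) X by (intro sum.cong refl) (simp add: Phi_eq_fidelity algebra_simps)
  also have "\<dots> = (1 - t) * (\<Sum>j=1..n. w j * Re (trace (A j))) + (\<Sum>j=1..n. w j) * (t * Re (trace X))
      - (\<Sum>j=1..n. w j * fidelity t (A j) X)"
    by (simp add: sum.distrib sum_subtractf sum_distrib_left sum_distrib_right)
  finally show ?thesis using assms(3) by (simp add: barycenter_objective_def)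
qed

lemma pos_prob_vector_nonempty:
  assumes "pos_prob_vector n w" shows "{1..n} \<noteq> {}"
proof
  assume "{1..n} = {}"
  then have "sum w {1..n} = 0" by (simp only: sum.empty)
  then show False using assms by (simp add: pos_prob_vector_def)
qed

lemma objective_midpoint:
  assumes t: "0 < t" "t < 1" and w: "pos_prob_vector n w"
    and pd: "\<forall>j\<in>{1..n}. A j \<in> posdef_mats"
    and X: "X \<in> posdef_mats" and Y: "Y \<in> posdef_mats" and ne: "X \<noteq> Y"
  shows "barycenter_objective t n w A ((1/2) *\<^sub>R (X + Y))
    < (barycenter_objective t n w A X + barycenter_objective t n w A Y) / 2"
proof -
  note A = pd[rule_format]
  have wpos: "0 < w j" if "j \<in> {1..n}" for j using w that by (simp add: pos_prob_vector_def)
  have "{1..n} \<noteq> {}" by (rule pos_prob_vector_nonempty[OF w])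
  then have "(\<Sum>j=1..n. w j * ((fidelity t (A j) X + fidelity t (A j) Y) / 2))
    < (\<Sum>j=1..n. w j * fidelity t (A j) ((1/2) *\<^sub>R (X + Y)))"
    by (intro sum_strict_mono mult_strict_left_mono fidelity_strictly_midpoint_concave A X Y ne t wpos) auto
  moreover have "(\<Sum>j=1..n. w j * ((fidelity t (A j) X + fidelity t (A j) Y) / 2))
     = ((\<Sum>j=1..n. w j * fidelity t (A j) X) + (\<Sum>j=1..n. w j * fidelity t (A j) Y)) / 2"
    by (simp add: sum.distrib distrib_left sum_divide_distrib add_divide_distrib)
  ultimately show ?thesis
    by (simp add: barycenter_objective_def trace_scaleR trace_add algebra_simps add_divide_distrib)
qed

text \<open>The shift by \<open>\<delta>\<close> costs \<open>t \<delta> m\<close> in the trace term for \<open>m \<times> m\<close> matrices. The fidelity to a single \<open>A_j\<close> already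
regains this for matrices close to the boundary, and the other fidelities do not decrease.\<close>
lemma objective_shift_decreases:
  assumes t: "0 < t" "t < 1" and w: "pos_prob_vector n w"
    and pd: "\<forall>j\<in>{1..n}. A j \<in> posdef_mats"
  shows "\<exists>\<delta>>0. \<forall>X :: complex^'m^'m. X \<in> posdef_mats \<longrightarrow> (\<exists>x. qf X x < \<delta> * (norm x)^2) \<longrightarrow>
      barycenter_objective t n w A (X + \<delta> *\<^sub>R mat 1) \<le> barycenter_objective t n w A X"
proof -
  note A = pd[rule_format]
  have wpos: "0 < w j" if "j \<in> {1..n}" for j using w that by (simp add: pos_prob_vector_def)
  have "{1..n} \<noteq> {}" by (rule pos_prob_vector_nonempty[OF w])
  then have 1: "1 \<in> {1..n}" by auto
  \<comment> \<open>the rate at which the term with index 1 alone compensates the growth of the trace\<close>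
  define R where "R = t * real CARD('m) / w 1"
  have R: "0 < R" using t wpos[OF 1] by (simp add: R_def)
  obtain \<delta> where \<delta>: "0 < \<delta>" and
    incr: "\<And>X. X \<in> posdef_mats \<Longrightarrow> \<exists>x. qf X x < \<delta> * (norm x)^2 \<Longrightarrow>
       fidelity t (A 1) X + R * \<delta> \<le> fidelity t (A 1) (X + \<delta> *\<^sub>R mat 1)"
    using fidelity_shift_lower[OF A[OF 1] t R] by metis
  have "barycenter_objective t n w A (X + \<delta> *\<^sub>R mat 1) \<le> barycenter_objective t n w A X"
    if X: "X \<in> posdef_mats" and ex: "\<exists>x. qf X x < \<delta> * (norm x)^2" for X :: "complex^'m^'m"
  proof -
    define D where "D j = w j * (fidelity t (A j) (X + \<delta> *\<^sub>R mat 1) - fidelity t (A j) X)" for j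
    have D0: "0 \<le> D j" if "j \<in> {1..n}" for j
    proof -
      have "fidelity t (A j) X \<le> fidelity t (A j) (X + \<delta> *\<^sub>R mat 1)"
        by (intro fidelity_mono A that X posdef_shift \<delta> t)
          (use \<delta> in \<open>simp add: qf_add qf_scaleR qf_mat_1\<close>)
      then show ?thesis using wpos[OF that] by (simp add: D_def)
    qed
    have "t * (\<delta> * real CARD('m)) = w 1 * (R * \<delta>)"
      using wpos[OF 1] by (simp add: R_def)
    also have "\<dots> \<le> D 1"
      unfolding D_def using incr[OF X ex] wpos[OF 1] by (intro mult_left_mono) auto
    also have "\<dots> \<le> (\<Sum>j=1..n. D j)"
      by (rule member_le_sum[OF 1]) (use D0 in auto)
    finally show ?thesis
      by (simp add: barycenter_objective_def trace_shift D_def right_diff_distrib sum_subtractf distrib_left)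
  qed
  with \<delta> show ?thesis by blast
qed

text \<open>A positive definite matrix with trace \<open>s\<close> lies below \<open>s\<close> times the identity, so by monotonicity and
homogeneity the fidelity term is at most \<open>K s^t\<close>, which \<open>t s\<close> dominates.\<close>
lemma objective_coercive:
  assumes t: "0 < t" "t < 1" and w: "pos_prob_vector n w"
    and pd: "\<forall>j\<in>{1..n}. A j \<in> posdef_mats"
  shows "\<exists>s0. \<forall>X :: complex^'m^'m. X \<in> posdef_mats \<longrightarrow> s0 < Re (trace X) \<longrightarrow>
      c < barycenter_objective t n w A X"
proof -
  note A = pd[rule_format]
  have wpos: "0 < w j" if "j \<in> {1..n}" for j using w that by (simp add: pos_prob_vector_def)
  define K where "K = max 1 (\<Sum>j=1..n. w j * fidelity t (A j) (mat 1))"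
  \<comment> \<open>beyond the first bound \<open>K s^t \<le> t s/2\<close>, beyond the second \<open>c < t s/2\<close>\<close>
  define s0 where "s0 = max ((2 * K / t) powr (1 / (1 - t))) (2 * c / t)"
  have "c < barycenter_objective t n w A X"
    if X: "X \<in> posdef_mats" and s: "s0 < Re (trace X)" for X :: "complex^'m^'m"
  proof -
    let ?s = "Re (trace X)"
    have spos: "0 < ?s" by (rule posdef_trace_bounds(3)[OF X])
    have "fidelity t (A j) X \<le> ?s powr t * fidelity t (A j) (mat 1)" if j: "j \<in> {1..n}" for j
    proof -
      have "fidelity t (A j) X \<le> fidelity t (A j) (?s *\<^sub>R mat 1)"
        by (intro fidelity_mono A j X posdef_scaleR posdef_mat_1 spos t)
          (simp add: qf_scaleR qf_mat_1 posdef_trace_bounds(2)[OF X])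
      also have "\<dots> = ?s powr t * fidelity t (A j) (mat 1)"
        by (rule fidelity_scaleR[OF A[OF j] posdef_mat_1 spos])
      finally show ?thesis .
    qed
    then have "(\<Sum>j=1..n. w j * fidelity t (A j) X)
        \<le> (\<Sum>j=1..n. w j * (?s powr t * fidelity t (A j) (mat 1)))"
      by (intro sum_mono mult_left_mono) (auto simp: wpos less_imp_le)
    also have "\<dots> = ?s powr t * (\<Sum>j=1..n. w j * fidelity t (A j) (mat 1))"
      by (simp add: sum_distrib_left mult_ac)
    also have "\<dots> \<le> ?s powr t * K" by (intro mult_left_mono) (auto simp: K_def)
    also have "\<dots> \<le> ?s powr t * (t / 2 * ?s powr (1 - t))"
    proof (rule mult_left_mono)
      have "0 < K" by (simp add: K_def)
      then have "2 * K / t = ((2 * K / t) powr (1 / (1 - t))) powr (1 - t)"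
        using t by (simp add: powr_powr)
      also have "\<dots> \<le> ?s powr (1 - t)"
        using s t by (intro powr_mono2) (auto simp: s0_def)
      finally show "K \<le> t / 2 * ?s powr (1 - t)" using t by (simp add: field_simps)
    qed simp
    also have "\<dots> = t / 2 * ?s"
      using spos powr_add[of ?s t "1 - t"] by simp
    finally have "t / 2 * ?s \<le> barycenter_objective t n w A X"
      by (simp add: barycenter_objective_def)
    moreover have "c < t / 2 * ?s"
    proof -
      have "2 * c / t < ?s" using s by (simp add: s0_def)
      then show ?thesis using t by (simp add: field_simps)
    qed
    ultimately show ?thesis by linarith
  qed
  then show ?thesis by blast
qed

lemma continuous_on_objective:
  assumes t: "0 < t" "t < 1" and pd: "\<forall>j\<in>{1..n}. A j \<in> posdef_mats"
  shows "continuous_on posdef_mats (barycenter_objective t n w A)"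
  unfolding barycenter_objective_def
  by (intro continuous_intros linear_imp_continuous_on[OF linear_trace] continuous_on_fidelity pd[rule_format] t)

text \<open>The lower bound keeps limits positive definite, and the trace of a positive definite matrix bounds its
norm.\<close>
lemma compact_posdef_slab:
  assumes \<delta>: "0 < \<delta>"
  shows "compact {X :: complex^'m^'m. hermitian_mat X \<and> (\<forall>x. \<delta> * (norm x)^2 \<le> qf X x) \<and> Re (trace X) \<le> s}"
    (is "compact ?K")
    and "{X :: complex^'m^'m. hermitian_mat X \<and> (\<forall>x. \<delta> * (norm x)^2 \<le> qf X x) \<and> Re (trace X) \<le> s} \<subseteq> posdef_mats"
proof -
  show sub: "?K \<subseteq> posdef_mats"
  proof
    fix X assume X: "X \<in> ?K"
    have "0 < qf X x" if "x \<noteq> 0" for x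
    proof -
      have "0 < \<delta> * (norm x)^2" using \<delta> that by simp
      also have "\<dots> \<le> qf X x" using X by simp
      finally show ?thesis .
    qed
    then show "X \<in> posdef_mats" using X by (simp add: posdef_iff)
  qed
  have "bounded ?K"
    unfolding bounded_iff
    by (intro exI[of _ s] ballI) (use sub posdef_trace_bounds(1) in fastforce)
  moreover have "closed ?K"
    unfolding hermitian_mat_def
    by (intro closed_Collect_conj closed_Collect_all closed_Collect_eq closed_Collect_le continuous_intros
        linear_imp_continuous_on linear_adjoint linear_qf linear_trace)
  ultimately show "compact ?K" by (simp add: compact_eq_bounded_closed)
qed

text \<open>Every competitor can be replaced by one that is bounded below by \<open>\<delta>\<close> at no cost, and competitors with
large trace lose to the identity. This leaves a compact set.\<close>
theorem objective_has_minimizer: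
  assumes t: "0 < t" "t < 1" and w: "pos_prob_vector n w"
    and pd: "\<forall>j\<in>{1..n}. A j \<in> posdef_mats"
  obtains X :: "complex^'m^'m" where "X \<in> posdef_mats"
    "\<And>Y. Y \<in> posdef_mats \<Longrightarrow> barycenter_objective t n w A X \<le> barycenter_objective t n w A Y"
proof -
  let ?f = "barycenter_objective t n w A"
  obtain \<delta> where \<delta>: "0 < \<delta>" and dec: "\<And>X :: complex^'m^'m. X \<in> posdef_mats \<Longrightarrow> \<exists>x. qf X x < \<delta> * (norm x)^2 \<Longrightarrow>
      ?f (X + \<delta> *\<^sub>R mat 1) \<le> ?f X"
    using objective_shift_decreases[OF t w pd] by blast
  have push: "\<exists>Z\<in>posdef_mats. ?f Z \<le> ?f X \<and> (\<forall>x. \<delta> * (norm x)^2 \<le> qf Z x)"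
    if X: "X \<in> posdef_mats" for X :: "complex^'m^'m"
  proof (cases "\<exists>x. qf X x < \<delta> * (norm x)^2")
    case True
    then show ?thesis
      using dec[OF X] posdef_shift[OF X \<delta>] qf_nonneg[OF X]
      by (intro bexI[of _ "X + \<delta> *\<^sub>R mat 1"]) (auto simp: qf_add qf_scaleR qf_mat_1)
  next
    case False
    then show ?thesis using X by (intro bexI[of _ X]) (auto simp: not_less)
  qed
  obtain s0 where s0: "\<And>X :: complex^'m^'m. X \<in> posdef_mats \<Longrightarrow> s0 < Re (trace X) \<Longrightarrow> ?f (mat 1) < ?f X"
    using objective_coercive[OF t w pd, where c = "?f (mat 1)"] by blast
  define K where "K = {X :: complex^'m^'m. hermitian_mat X \<and> (\<forall>x. \<delta> * (norm x)^2 \<le> qf X x) \<and> Re (trace X) \<le> s0}"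
  have cpt: "compact K" and sub: "K \<subseteq> posdef_mats"
    unfolding K_def by (rule compact_posdef_slab[OF \<delta>])+
  have memK: "Z \<in> K" if "Z \<in> posdef_mats" "?f Z \<le> ?f (mat 1)" "\<forall>x. \<delta> * (norm x)^2 \<le> qf Z x" for Z
    using that s0[of Z] by (force simp: K_def posdef_iff not_less[symmetric])
  obtain Z0 where Z0: "Z0 \<in> K" "?f Z0 \<le> ?f (mat 1)"
    using push[OF posdef_mat_1] memK by blast
  obtain X where X: "X \<in> K" "\<And>Y. Y \<in> K \<Longrightarrow> ?f X \<le> ?f Y"
    using continuous_attains_inf[OF cpt _ continuous_on_subset[OF continuous_on_objective[OF t pd] sub]] Z0(1)
    by blast
  have "?f X \<le> ?f Y" if Y: "Y \<in> posdef_mats" for Y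
  proof (cases "?f Y \<le> ?f (mat 1)")
    case True
    then obtain Z where "Z \<in> K" "?f Z \<le> ?f Y" using push[OF Y] memK by force
    then show ?thesis using X(2) by force
  next
    case False
    then show ?thesis using X(2)[OF Z0(1)] Z0(2) by linarith
  qed
  with X(1) sub that show ?thesis by blast
qed

lemma minimizer_unique:
  assumes t: "0 < t" "t < 1" and w: "pos_prob_vector n w"
    and pd: "\<forall>j\<in>{1..n}. A j \<in> posdef_mats"
    and X: "X \<in> posdef_mats" "\<And>Y. Y \<in> posdef_mats \<Longrightarrow> barycenter_objective t n w A X \<le> barycenter_objective t n w A Y"
    and Z: "Z \<in> posdef_mats" "\<And>Y. Y \<in> posdef_mats \<Longrightarrow> barycenter_objective t n w A Z \<le> barycenter_objective t n w A Y"
  shows "X = Z"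
proof (rule ccontr)
  assume ne: "X \<noteq> Z"
  define M where "M = (1/2) *\<^sub>R (X + Z)"
  have M: "M \<in> posdef_mats" unfolding M_def by (intro posdef_scaleR posdef_add X Z) simp
  show False
    using objective_midpoint[OF t w pd X(1) Z(1) ne, folded M_def] X(2)[OF M] Z(2)[OF M] by simp
qed

lemma is_arg_min_objective:
  assumes pd: "\<forall>j\<in>{1..n}. A j \<in> posdef_mats" and w: "pos_prob_vector n w"
  shows "is_arg_min (\<lambda>X. \<Sum>j=1..n. w j * Phi t (A j) X) (\<lambda>X. X \<in> posdef_mats) X \<longleftrightarrow>
    X \<in> posdef_mats \<and> (\<forall>Y\<in>posdef_mats. barycenter_objective t n w A X \<le> barycenter_objective t n w A Y)"
proof (cases "X \<in> posdef_mats")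
  case True
  then show ?thesis
    using sum_Phi_eq_objective[OF pd, of _ w t] w unfolding is_arg_min_def pos_prob_vector_def
    by (auto simp: not_less)
qed (simp add: is_arg_min_def)

lemma barycenter_eqI:
  assumes t: "0 < t" "t < 1" and w: "pos_prob_vector n w"
    and pd: "\<forall>j\<in>{1..n}. A j \<in> posdef_mats"
    and X: "X \<in> posdef_mats" "\<And>Y. Y \<in> posdef_mats \<Longrightarrow> barycenter_objective t n w A X \<le> barycenter_objective t n w A Y"
  shows "barycenter t n w A = X"
  unfolding barycenter_def is_arg_min_objective[OF pd w]
  by (rule the_equality) (use X minimizer_unique[OF t w pd] in blast)+

lemma barycenter_minimizes:
  assumes t: "0 < t" "t < 1" and w: "pos_prob_vector n w"
    and pd: "\<forall>j\<in>{1..n}. A j \<in> posdef_mats"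
  shows "barycenter t n w A \<in> posdef_mats"
    and "Y \<in> posdef_mats \<Longrightarrow> barycenter_objective t n w A (barycenter t n w A) \<le> barycenter_objective t n w A Y"
proof -
  obtain X where X: "X \<in> posdef_mats"
    "\<And>Y. Y \<in> posdef_mats \<Longrightarrow> barycenter_objective t n w A X \<le> barycenter_objective t n w A Y"
    using objective_has_minimizer[OF t w pd] by metis
  have "barycenter t n w A = X" by (rule barycenter_eqI[OF t w pd X])
  with X show "barycenter t n w A \<in> posdef_mats"
    "Y \<in> posdef_mats \<Longrightarrow> barycenter_objective t n w A (barycenter t n w A) \<le> barycenter_objective t n w A Y"
    by auto
qed

section \<open>Properties of the barycenter\<close>

lemma barycenter_unitary_conj:
  assumes t: "0 < t" "t < 1" and w: "pos_prob_vector n w"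
    and pd: "\<forall>j\<in>{1..n}. A j \<in> posdef_mats" and U: "unitary_mat U"
  shows "barycenter t n w (\<lambda>j. U ** A j ** adjoint_mat U) = U ** barycenter t n w A ** adjoint_mat U"
proof (rule barycenter_eqI[OF t w])
  note A = pd[rule_format]
  let ?f = "barycenter_objective t n w A"
  let ?g = "barycenter_objective t n w (\<lambda>j. U ** A j ** adjoint_mat U)"
  show "\<forall>j\<in>{1..n}. U ** A j ** adjoint_mat U \<in> posdef_mats"
    by (intro ballI posdef_unitary_conj U A)
  show "U ** barycenter t n w A ** adjoint_mat U \<in> posdef_mats"
    by (intro posdef_unitary_conj U barycenter_minimizes t w pd)
  have inv: "?g (U ** X ** adjoint_mat U) = ?f X" if "X \<in> posdef_mats" for X
    using that by (simp add: barycenter_objective_def trace_unitary_conj[OF U] fidelity_unitary_conj[OF U A])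
  fix Y :: "complex^'a^'a" assume Y: "Y \<in> posdef_mats"
  define X where "X = adjoint_mat U ** Y ** U"
  have X: "X \<in> posdef_mats"
    using posdef_unitary_conj[OF unitary_adjoint[OF U] Y] by (simp add: X_def adjoint_mat_adjoint_mat)
  have "U ** X ** adjoint_mat U = (U ** adjoint_mat U) ** Y ** (U ** adjoint_mat U)"
    by (simp add: X_def matrix_mul_assoc)
  then have UX: "U ** X ** adjoint_mat U = Y" using U by (simp add: unitary_mat_def)
  have "?f (barycenter t n w A) \<le> ?f X" by (rule barycenter_minimizes(2)[OF t w pd X])
  then show "?g (U ** barycenter t n w A ** adjoint_mat U) \<le> ?g Y"
    using inv[OF X] inv[OF barycenter_minimizes(1)[OF t w pd]] by (simp add: UX)
qed

lemma barycenter_permute: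
  assumes "\<sigma> permutes {1..n}"
  shows "barycenter t n (\<lambda>j. w (\<sigma> j)) (\<lambda>j. A (\<sigma> j)) = barycenter t n w A"
proof -
  have "(\<Sum>j=1..n. w (\<sigma> j) * Phi t (A (\<sigma> j)) X) = (\<Sum>j=1..n. w j * Phi t (A j) X)" for X
    using sum.permute[OF assms, of "\<lambda>j. w j * Phi t (A j) X"] by (simp add: o_def)
  then show ?thesis by (simp add: barycenter_def)
qed

lemma diag_in_column: "unitary_mat U \<Longrightarrow> diag_in U d *v column i U = d i *\<^sub>R column i U"
proof -
  assume U: "unitary_mat U"
  have "diag_in U d ** U = U ** real_diag_mat d ** (adjoint_mat U ** U)"
    by (simp add: diag_in_def matrix_mul_assoc)
  then have "diag_in U d ** U = U ** real_diag_mat d" using U by (simp add: unitary_mat_def)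
  then show ?thesis
    by (simp add: vec_eq_iff matrix_vector_column matrix_mult_diag)
      (simp add: column_def scaleR_conv_of_real[where 'a = complex])
qed

text \<open>Both sides are quadratic forms of functions of \<open>X\<close>, so the scalar tangent inequality at the eigenvalues
of \<open>X\<close> suffices, and \<open>x\<close> can be any unit vector, such as an eigenvector of some other matrix.\<close>
lemma qf_mat_powr_tangent:
  assumes X: "X \<in> posdef_mats" and t: "0 < t" "t < 1" and s: "0 < s" and x: "norm x = 1"
  shows "qf (mat_powr X t) x \<le> s powr (t - 1) * ((1 - t) * s + t * qf X x)"
proof -
  obtain U d where U: "unitary_mat U" and Xd: "X = diag_in U d" and d: "\<And>i. 0 < d i"
    using posdef_spectral[OF X] by metis
  have "qf (mat_powr X t) x \<le> qf (diag_in U (\<lambda>i. s powr (t - 1) * ((1 - t) * s + t * d i))) x"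
    unfolding Xd mat_powr_diag_in[OF U] by (intro qf_diag_in_mono powr_tangent t s d)
  also have "diag_in U (\<lambda>i. s powr (t - 1) * ((1 - t) * s + t * d i))
     = s powr (t - 1) *\<^sub>R (((1 - t) * s) *\<^sub>R mat 1 + t *\<^sub>R X)"
    by (simp add: Xd diag_in_const[OF U, symmetric] diag_in_scaleR diag_in_add)
  finally show ?thesis using x by (simp add: qf_scaleR qf_add qf_mat_1)
qed

text \<open>In a common eigenbasis \<open>u_i\<close> of the \<open>A_j\<close>, let \<open>a j i\<close> be their eigenvalues, \<open>b i\<close> the eigenvalues of
\<open>\<Sum>j. w j A_j^(1-t)\<close>, and \<open>s i\<close> those of the claimed minimizer, so \<open>b i = (s i)^(1-t)\<close>. For any \<open>Y\<close> with
diagonal entries \<open>y i = \<langle>u_i, Y u_i\<rangle>\<close>, the tangent inequality at the point \<open>a j i * s i\<close> bounds the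
\<open>i\<close>-th term of the fidelity to \<open>A_j\<close> by \<open>(a j i)^(1-t) (s i)^(t-1) ((1-t) s i + t y i)\<close>. The weighted
sum over \<open>j\<close> turns the powers of \<open>a j i\<close> into \<open>b i\<close>, which cancels \<open>(s i)^(t-1)\<close>, and the terms \<open>t y i\<close>
add up to \<open>t tr Y\<close>.\<close>
lemma barycenter_commuting:
  fixes A :: "nat \<Rightarrow> complex^'m^'m"
  assumes t: "0 < t" "t < 1" and w: "pos_prob_vector n w"
    and pd: "\<forall>j\<in>{1..n}. A j \<in> posdef_mats"
    and comm: "\<And>i j. i \<in> {1..n} \<Longrightarrow> j \<in> {1..n} \<Longrightarrow> A i ** A j = A j ** A i"
  shows "barycenter t n w A = mat_powr (\<Sum>j=1..n. w j *\<^sub>R mat_powr (A j) (1 - t)) (1 / (1 - t))"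
proof -
  note A = pd[rule_format]
  have wpos: "0 < w j" if "j \<in> {1..n}" for j using w that by (simp add: pos_prob_vector_def)
  have ne: "{1..n} \<noteq> {}" by (rule pos_prob_vector_nonempty[OF w])
  obtain U where U: "unitary_mat U" and diag: "\<And>B. B \<in> set (map A [1..<Suc n]) \<Longrightarrow> \<exists>d. B = diag_in U d"
    by (rule simultaneous_diagonalization[of "map A [1..<Suc n]"])
      (use A comm in \<open>auto simp: posdef_iff\<close>)
  have "\<exists>d. A j = diag_in U d" if "j \<in> {1..n}" for j
    by (rule diag, unfold set_map set_upt, rule imageI) (use that in simp)
  then obtain a where Aa: "\<And>j. j \<in> {1..n} \<Longrightarrow> A j = diag_in U (a j)" by metis
  have apos: "0 < a j i" if "j \<in> {1..n}" for i j
    using A[OF that] posdef_diag_in[OF U] Aa[OF that] by metis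
  define b where "b i = (\<Sum>j=1..n. w j * a j i powr (1 - t))" for i
  define s where "s i = b i powr (1 / (1 - t))" for i
  have b: "0 < b i" for i
    unfolding b_def using ne wpos apos[of _ i]
    by (intro sum_pos) (auto simp del: atLeastAtMost_iff simp: less_imp_neq[THEN not_sym])
  have s: "0 < s i" for i using b[of i] by (simp add: s_def)
  have bs: "b i = s i powr (1 - t)" for i
    using t b[of i] by (simp add: s_def powr_powr)
  have "(\<Sum>j=1..n. w j *\<^sub>R mat_powr (A j) (1 - t)) = (\<Sum>j=1..n. diag_in U (\<lambda>i. w j * a j i powr (1 - t)))"
    by (intro sum.cong refl) (simp add: Aa mat_powr_diag_in[OF U] diag_in_scaleR)
  then have rhs: "mat_powr (\<Sum>j=1..n. w j *\<^sub>R mat_powr (A j) (1 - t)) (1 / (1 - t)) = diag_in U s"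
    by (simp add: diag_in_sum[OF U] mat_powr_diag_in[OF U] b_def s_def[abs_def])
  have S: "diag_in U s \<in> posdef_mats" using s by (simp add: posdef_diag_in[OF U])
  have fid: "fidelity t (A j) X =
      (\<Sum>i\<in>UNIV. a j i powr (1 - 2 * t) * qf (mat_powr (mat_powr (A j) (1/2) ** X ** mat_powr (A j) (1/2)) t) (column i U))"
    if "j \<in> {1..n}" for j X
    unfolding fidelity_def by (subst Aa[OF that]) (simp add: mat_powr_diag_in[OF U] Re_trace_diag_in_mult)
  show ?thesis
    unfolding rhs
  proof (rule barycenter_eqI[OF t w pd S])
    fix Y :: "complex^'m^'m" assume Y: "Y \<in> posdef_mats"
    define y where "y i = qf Y (column i U)" for i
    have trY: "Re (trace Y) = (\<Sum>i\<in>UNIV. y i)"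
      using Re_trace_diag_in_mult[of U "\<lambda>_. 1" Y] by (simp add: diag_in_const[OF U] y_def)
    have "fidelity t (A j) Y \<le> (\<Sum>i\<in>UNIV. a j i powr (1 - t) * (s i powr (t - 1) * ((1 - t) * s i + t * y i)))"
      if j: "j \<in> {1..n}" for j
      unfolding fid[OF j]
    proof (rule sum_mono)
      fix i
      let ?a = "a j i" and ?R = "mat_powr (A j) (1/2)"
      have ap: "0 < ?a" by (rule apos[OF j])
      have R: "?R \<in> posdef_mats" by (intro mat_powr_posdef A j)
      have "?R *v column i U = (?a powr (1/2)) *\<^sub>R column i U"
        by (simp add: Aa[OF j] mat_powr_diag_in[OF U] diag_in_column[OF U])
      then have "qf (?R ** Y ** ?R) (column i U) = ?a powr (1/2) * (?a powr (1/2) * y i)"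
        unfolding qf_congruence_posdef[OF R] y_def by (simp add: qf_def matrix_vector_scaleR)
      also have "\<dots> = ?a * y i"
        using ap by (simp add: mult.assoc[symmetric] powr_add[symmetric])
      finally have "qf (mat_powr (?R ** Y ** ?R) t) (column i U)
          \<le> (?a * s i) powr (t - 1) * ((1 - t) * (?a * s i) + t * (?a * y i))"
        using qf_mat_powr_tangent[OF posdef_congruence[OF R Y] t _ norm_column_unitary[OF U], of "?a * s i" i]
          ap s[of i] by simp
      then have "?a powr (1 - 2 * t) * qf (mat_powr (?R ** Y ** ?R) t) (column i U)
          \<le> ?a powr (1 - 2 * t) * ((?a * s i) powr (t - 1) * ((1 - t) * (?a * s i) + t * (?a * y i)))"
        by (intro mult_left_mono) auto
      also have "\<dots> = (?a powr (1 - 2 * t) * ?a powr (t - 1) * ?a powr 1) * (s i powr (t - 1) * ((1 - t) * s i + t * y i))"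
        using ap s[of i] by (simp add: powr_mult algebra_simps)
      also have "?a powr (1 - 2 * t) * ?a powr (t - 1) * ?a powr 1 = ?a powr (1 - t)"
        by (simp only: powr_add[symmetric]) simp
      finally show "?a powr (1 - 2 * t) * qf (mat_powr (?R ** Y ** ?R) t) (column i U)
          \<le> ?a powr (1 - t) * (s i powr (t - 1) * ((1 - t) * s i + t * y i))" .
    qed
    then have "(\<Sum>j=1..n. w j * fidelity t (A j) Y)
        \<le> (\<Sum>j=1..n. w j * (\<Sum>i\<in>UNIV. a j i powr (1 - t) * (s i powr (t - 1) * ((1 - t) * s i + t * y i))))"
      by (intro sum_mono mult_left_mono) (auto simp: wpos less_imp_le)
    also have "\<dots> = (\<Sum>i\<in>UNIV. b i * (s i powr (t - 1) * ((1 - t) * s i + t * y i)))"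
      unfolding b_def sum_distrib_left sum_distrib_right by (subst sum.swap) (simp add: mult.assoc)
    also have "\<dots> = (\<Sum>i\<in>UNIV. (1 - t) * s i + t * y i)"
    proof (intro sum.cong refl)
      fix i show "b i * (s i powr (t - 1) * ((1 - t) * s i + t * y i)) = (1 - t) * s i + t * y i"
        using s[of i] unfolding bs by (simp add: mult.assoc[symmetric] powr_add[symmetric])
    qed
    finally have lower: "- (\<Sum>i\<in>UNIV. (1 - t) * s i) \<le> barycenter_objective t n w A Y"
      by (simp add: barycenter_objective_def trY sum.distrib sum_distrib_left)
    have "fidelity t (A j) (diag_in U s) = (\<Sum>i\<in>UNIV. a j i powr (1 - t) * s i powr t)" if j: "j \<in> {1..n}" for j
      unfolding fid[OF j]
    proof (intro sum.cong refl)
      fix i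
      let ?a = "a j i"
      have ap: "0 < ?a" by (rule apos[OF j])
      have "qf (mat_powr (mat_powr (A j) (1/2) ** diag_in U s ** mat_powr (A j) (1/2)) t) (column i U)
          = (?a powr (1/2) * s i * ?a powr (1/2)) powr t"
        by (simp add: Aa[OF j] mat_powr_diag_in[OF U] diag_in_mult[OF U] qf_diag_in_column[OF U])
      also have "?a powr (1/2) * s i * ?a powr (1/2) = (?a powr (1/2) * ?a powr (1/2)) * s i" by simp
      also have "\<dots> = ?a * s i" using ap by (simp only: powr_add[symmetric]) simp
      also have "(?a * s i) powr t = ?a powr t * s i powr t" using ap s[of i] by (simp add: powr_mult)
      finally show "?a powr (1 - 2 * t) * qf (mat_powr (mat_powr (A j) (1/2) ** diag_in U s ** mat_powr (A j) (1/2)) t) (column i U)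
          = ?a powr (1 - t) * s i powr t"
        by (simp add: mult.assoc[symmetric] powr_add[symmetric])
    qed
    then have "(\<Sum>j=1..n. w j * fidelity t (A j) (diag_in U s)) = (\<Sum>j=1..n. w j * (\<Sum>i\<in>UNIV. a j i powr (1 - t) * s i powr t))"
      by (intro sum.cong refl) simp
    also have "\<dots> = (\<Sum>i\<in>UNIV. b i * s i powr t)"
      unfolding b_def sum_distrib_left sum_distrib_right by (subst sum.swap) (simp add: mult.assoc)
    also have "\<dots> = (\<Sum>i\<in>UNIV. s i)"
      using s unfolding bs by (simp add: powr_add[symmetric] less_imp_le)
    finally have "barycenter_objective t n w A (diag_in U s) = - (\<Sum>i\<in>UNIV. (1 - t) * s i)"
      by (simp add: barycenter_objective_def Re_trace_diag_in[OF U] left_diff_distrib sum_subtractf sum_distrib_left)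
    then show "barycenter_objective t n w A (diag_in U s) \<le> barycenter_objective t n w A Y"
      using lower by simp
  qed
qed

theorem theorem4p6:
  fixes t :: real and n :: nat and w :: "nat \<Rightarrow> real"
    and A :: "nat \<Rightarrow> complex^'m^'m"
  assumes "0 < t" and "t < 1"
    and "pos_prob_vector n w"
    and "\<And>j. j \<in> {1..n} \<Longrightarrow> A j \<in> posdef_mats"
  shows "((\<forall>i\<in>{1..n}. \<forall>j\<in>{1..n}. A i ** A j = A j ** A i) \<longrightarrow>
           barycenter t n w A =
             mat_powr (\<Sum>j=1..n. w j *\<^sub>R mat_powr (A j) (1 - t)) (1 / (1 - t)))
       \<and> (\<forall>\<sigma>. \<sigma> permutes {1..n} \<longrightarrow>
           barycenter t n (\<lambda>j. w (\<sigma> j)) (\<lambda>j. A (\<sigma> j)) = barycenter t n w A)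
       \<and> (\<forall>U. unitary_mat U \<longrightarrow>
           barycenter t n w (\<lambda>j. U ** A j ** adjoint_mat U) =
             U ** barycenter t n w A ** adjoint_mat U)"
proof -
  have pd: "\<forall>j\<in>{1..n}. A j \<in> posdef_mats" using assms(4) by blast
  show ?thesis
  proof (intro conjI allI impI)
    assume "\<forall>i\<in>{1..n}. \<forall>j\<in>{1..n}. A i ** A j = A j ** A i"
    then show "barycenter t n w A =
        mat_powr (\<Sum>j=1..n. w j *\<^sub>R mat_powr (A j) (1 - t)) (1 / (1 - t))"
      by (intro barycenter_commuting assms(1-3) pd) blast+
  next
    fix \<sigma> assume "\<sigma> permutes {1..n}"
    then show "barycenter t n (\<lambda>j. w (\<sigma> j)) (\<lambda>j. A (\<sigma> j)) = barycenter t n w A"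
      by (rule barycenter_permute)
  next
    fix U :: "complex^'m^'m" assume "unitary_mat U"
    then show "barycenter t n w (\<lambda>j. U ** A j ** adjoint_mat U) =
        U ** barycenter t n w A ** adjoint_mat U"
      by (intro barycenter_unitary_conj assms(1-3) pd)
  qed
qed

end
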